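(* Let $X\subset\mathbb{R}^m$ and $Y\subset\mathbb{R}^n$ be open, let $H\in\mathcal{G}_{ps}(X\times Y)$ and let $\widehat{H}:\mathcal{G}(Y)\to\mathcal{G}(X)$, $\widehat{H}(f)=\int_Y H(\cdot,y)f(y)\,\mathrm{d}y$, be the generalized integral operator with kernel $H$. Then $\widehat{H}=0$ (that is, $\widehat H(f)=0$ in $\mathcal{G}(X)$ for all $f\in\mathcal{G}(Y)$) if and only if $H=0$ in $\mathcal{G}(X\times Y)$.
   Context: For $\Omega\subset\mathbb{R}^d$ open, $K\Subset\Omega$ means that $K$ is a compact subset of $\Omega$, and for $l\in\mathbb{N}$, $f\in\mathcal{C}^\infty(\Omega)$ (complex valued), $p_{K,l}(f)=\sup_{x\in K,|\alpha|\le l}|\partial^\alpha f(x)|$. $\mathcal{E}_M(\Omega)$ is the set of nets $(u_\varepsilon)_{\varepsilon\in(0,1]}$ in $\mathcal{C}^\infty(\Omega)$ such that for all $K\Subset\Omega$, $l\in\mathbb{N}$ there is $n\in\mathbb{N}$ with $p_{K,l}(u_\varepsilon)=O(\varepsilon^{-n})$ as $\varepsilon\to0$; $\mathcal{I}(\Omega)$ is the set of nets such that for all $K,l$ and all $n\in\mathbb{N}$, $p_{K,l}(u_\varepsilon)=O(\varepsilon^{n})$ as $\varepsilon\to0$. $\mathcal{G}(\Omega)=\mathcal{E}_M(\Omega)/\mathcal{I}(\Omega)$ (a sheaf of algebras, with operations and restriction defined on representatives); $Cl(u_\varepsilon)_\varepsilon$ denotes the class. The support of $u\in\mathcal{G}(\Omega)$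 is the complement in $\Omega$ of the largest open subset on which $u$ restricts to $0$. $\mathcal{G}_{ps}(X\times Y)$ is the set of properly supported $g\in\mathcal{G}(X\times Y)$: for every relatively compact open subset $O_1$ of $X$ there is $K_2\Subset Y$ with $\mathrm{supp}\,g\cap(O_1\times Y)\subset O_1\times K_2$. For such $g=Cl(g_\varepsilon)_\varepsilon$, $\int_Y g(\cdot,y)\,\mathrm{d}y$ denotes the unique $G\in\mathcal{G}(X)$ such that, for each relatively compact open $O_1\subset X$ and each relatively compact open $W\subset Y$ with $\mathrm{supp}\,g\cap(O_1\times Y)\subset O_1\times W$, $G|_{O_1}$ is the class of $x\mapsto\int_W g_\varepsilon(x,y)\,\mathrm{d}y$ (this is well defined). For $H\in\mathcal{G}_{ps}(X\times Y)$ and $f\in\mathcal{G}(Y)$, the generalized function $(x,y)\mapsto H(x,y)f(y)$ lies in $\mathcal{G}_{ps}(X\times Y)$, so $\widehat H(f)$ is well defined. *)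

theory Defs
  imports "HOL-Analysis.Analysis" "HOL-Library.Landau_Symbols"
begin

definition partial_deriv :: "'a::euclidean_space \<Rightarrow> ('a \<Rightarrow> complex) \<Rightarrow> 'a \<Rightarrow> complex" where
  "partial_deriv b f x = vector_derivative (\<lambda>t. f (x + t *\<^sub>R b)) (at 0)"

text \<open>
  Multi-indices are encoded as words \<open>bs\<close> over the standard basis, with \<open>|\<alpha>|\<close> the length of the
  word. For smooth functions partial derivatives commute, so every word gives the
  \<open>\<partial>\<^sup>\<alpha>\<close> in which \<open>\<alpha>\<close> counts its letters, and every \<open>\<alpha>\<close> arises in this way.
\<close>

definition iter_partial :: "'a::euclidean_space list \<Rightarrow> ('a \<Rightarrow> complex) \<Rightarrow> 'a \<Rightarrow> complex" where
  "iter_partial bs f = foldr partial_deriv bs f"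

definition smooth_on :: "'a::euclidean_space set \<Rightarrow> ('a \<Rightarrow> complex) \<Rightarrow> bool" where
  "smooth_on \<Omega> f \<longleftrightarrow>
     (\<forall>bs. set bs \<subseteq> Basis \<longrightarrow> (\<forall>x\<in>\<Omega>. iter_partial bs f differentiable (at x)))"

text \<open>
  The element \<open>0\<close> is inserted because \<open>Sup {} :: real\<close> is unspecified; it makes the seminorm vanish
  for empty \<open>K\<close> and changes nothing otherwise.
\<close>

definition seminorm_p :: "'a::euclidean_space set \<Rightarrow> nat \<Rightarrow> ('a \<Rightarrow> complex) \<Rightarrow> real" where
  "seminorm_p K l f =
     Sup (insert 0 {cmod (iter_partial bs f x) | x bs. x \<in> K \<and> set bs \<subseteq> Basis \<and> length bs \<le> l})"

text \<open>
  Nets are total functions; only their values at \<open>0 < \<epsilon> \<le> 1\<close> and at points of \<open>\<Omega>\<close> matter, and nets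
  which agree there are identified in the quotient.
\<close>

type_synonym 'a net = "real \<Rightarrow> 'a \<Rightarrow> complex"

definition moderate_nets :: "'a::euclidean_space set \<Rightarrow> 'a net set" where
  "moderate_nets \<Omega> = {u. (\<forall>\<epsilon>\<in>{0<..1}. smooth_on \<Omega> (u \<epsilon>)) \<and>
     (\<forall>K l. compact K \<and> K \<subseteq> \<Omega> \<longrightarrow>
        (\<exists>n::nat. (\<lambda>\<epsilon>. seminorm_p K l (u \<epsilon>)) \<in> O[at_right 0](\<lambda>\<epsilon>. 1 / \<epsilon> ^ n)))}"

definition negligible_nets :: "'a::euclidean_space set \<Rightarrow> 'a net set" where
  "negligible_nets \<Omega> = {u. (\<forall>\<epsilon>\<in>{0<..1}. smooth_on \<Omega> (u \<epsilon>)) \<and>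
     (\<forall>K l. compact K \<and> K \<subseteq> \<Omega> \<longrightarrow>
        (\<forall>n::nat. (\<lambda>\<epsilon>. seminorm_p K l (u \<epsilon>)) \<in> O[at_right 0](\<lambda>\<epsilon>. \<epsilon> ^ n)))}"

definition colombeau_rel :: "'a::euclidean_space set \<Rightarrow> ('a net \<times> 'a net) set" where
  "colombeau_rel \<Omega> = {(u, v). u \<in> moderate_nets \<Omega> \<and> v \<in> moderate_nets \<Omega> \<and>
     (\<lambda>\<epsilon> x. u \<epsilon> x - v \<epsilon> x) \<in> negligible_nets \<Omega>}"

definition colombeau :: "'a::euclidean_space set \<Rightarrow> 'a net set set" where
  "colombeau \<Omega> = moderate_nets \<Omega> // colombeau_rel \<Omega>"

definition Cl :: "'a::euclidean_space set \<Rightarrow> 'a net \<Rightarrow> 'a net set" where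
  "Cl \<Omega> u = colombeau_rel \<Omega> `` {u}"

definition colombeau_zero :: "'a::euclidean_space set \<Rightarrow> 'a net set" where
  "colombeau_zero \<Omega> = Cl \<Omega> (\<lambda>\<epsilon> x. 0)"

text \<open>
  The operations on classes are given on representatives; each union below is over copies of
  one and the same class.
\<close>

definition colombeau_mult ::
  "'a::euclidean_space set \<Rightarrow> 'a net set \<Rightarrow> 'a net set \<Rightarrow> 'a net set" where
  "colombeau_mult \<Omega> U V = (\<Union>u\<in>U. \<Union>v\<in>V. Cl \<Omega> (\<lambda>\<epsilon> x. u \<epsilon> x * v \<epsilon> x))"

definition colombeau_restrict :: "'a::euclidean_space set \<Rightarrow> 'a net set \<Rightarrow> 'a net set" where
  "colombeau_restrict \<Omega>' U = (\<Union>u\<in>U. Cl \<Omega>' u)"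

definition colombeau_pullback_snd ::
  "'a::euclidean_space set \<Rightarrow> 'b::euclidean_space set \<Rightarrow> 'b net set \<Rightarrow> ('a \<times> 'b) net set" where
  "colombeau_pullback_snd X Y F = (\<Union>f\<in>F. Cl (X \<times> Y) (\<lambda>\<epsilon> (x, y). f \<epsilon> y))"

text \<open>By the sheaf property, the union below is itself one of the sets \<open>W\<close>, hence the largest.\<close>

definition colombeau_supp :: "'a::euclidean_space set \<Rightarrow> 'a net set \<Rightarrow> 'a set" where
  "colombeau_supp \<Omega> U =
     \<Omega> - \<Union>{W. open W \<and> W \<subseteq> \<Omega> \<and> colombeau_restrict W U = colombeau_zero W}"

definition rel_compact_open :: "'a::euclidean_space set \<Rightarrow> 'a set \<Rightarrow> bool" where
  "rel_compact_open W \<Omega> \<longleftrightarrow> open W \<and> compact (closure W) \<and> closure W \<subseteq> \<Omega>"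

definition colombeau_ps ::
  "'a::euclidean_space set \<Rightarrow> 'b::euclidean_space set \<Rightarrow> ('a \<times> 'b) net set set" where
  "colombeau_ps X Y = {g \<in> colombeau (X \<times> Y).
     \<forall>O1. rel_compact_open O1 X \<longrightarrow>
       (\<exists>K2. compact K2 \<and> K2 \<subseteq> Y \<and> colombeau_supp (X \<times> Y) g \<inter> (O1 \<times> Y) \<subseteq> O1 \<times> K2)}"

definition colombeau_integral ::
  "'a::euclidean_space set \<Rightarrow> 'b::euclidean_space set \<Rightarrow> ('a \<times> 'b) net set \<Rightarrow> 'a net set" where
  "colombeau_integral X Y U = (THE G. G \<in> colombeau X \<and>
     (\<forall>O1 W. rel_compact_open O1 X \<and> rel_compact_open W Y \<and>
        colombeau_supp (X \<times> Y) U \<inter> (O1 \<times> Y) \<subseteq> O1 \<times> W \<longrightarrow>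
        (\<forall>g\<in>U. colombeau_restrict O1 G = Cl O1 (\<lambda>\<epsilon> x. LINT y:W|lborel. g \<epsilon> (x, y)))))"

definition gen_integral_op ::
  "'a::euclidean_space set \<Rightarrow> 'b::euclidean_space set \<Rightarrow> ('a \<times> 'b) net set \<Rightarrow>
   'b net set \<Rightarrow> 'a net set" where
  "gen_integral_op X Y H F =
     colombeau_integral X Y (colombeau_mult (X \<times> Y) H (colombeau_pullback_snd X Y F))"

end

theory Submission imports Defs begin

text \<open>
  Let \<open>h\<close> represent \<open>H\<close> and suppose that the operator vanishes. Near a given point choose
  \<open>(x\<^sub>\<epsilon>, y\<^sub>\<epsilon>)\<close> maximising \<open>|h\<^sub>\<epsilon>|\<close> on a product of closed balls, a smooth bump \<open>\<psi>\<close> in \<open>y\<close>, and apply the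
  operator to the class of \<open>f\<^sub>\<epsilon> y = cnj (h\<^sub>\<epsilon> (x\<^sub>\<epsilon>, y)) * \<psi> y\<close>, which is moderate because \<open>h\<close> is. Since \<open>f\<close> has
  compact support, the result is represented globally by an integral over one fixed ball; its value
  at \<open>x\<^sub>\<epsilon>\<close> is the integral of \<open>|h\<^sub>\<epsilon> (x\<^sub>\<epsilon>, y)|\<^sup>2 * \<psi> y\<close>, which is therefore negligible. The Lipschitz constant of
  \<open>h\<^sub>\<epsilon>\<close> is moderate, so \<open>|h\<^sub>\<epsilon> (x\<^sub>\<epsilon>, y)|\<close> exceeds half of the maximum on a ball around \<open>y\<^sub>\<epsilon>\<close> whose radius is a
  power of \<open>\<epsilon>\<close>, unless the maximum is itself small; hence the maximum is negligible. A moderate net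
  with negligible values is negligible, by a second order Taylor estimate.
\<close>

text \<open>The place where \<open>h\<close> is large may move with \<open>\<epsilon>\<close>, so
  the test net is allowed to move with it: one class \<open>f\<close> built from the maximisers
  probes all of them at once. Reading the result off at the moving point is legitimate because a
  negligible net is small uniformly on the compact ball that contains every
  \<open>x_\<epsilon>\<close>. The conjugate makes the integrand nonnegative there, so an
  oscillating kernel cannot hide by cancellation. The only loss is the volume of the small ball, a
  power of \<open>\<epsilon>\<close>; it is harmless because the integral decays faster than any
  power, and order \<open>2 * n + (m + n) * d\<close>, with \<open>d\<close> the dimension of
  \<open>Y\<close>, is requested in order to get order \<open>n\<close>.

  Two obstacles shape the rest. Moderate and negligible nets need the same closure properties, so
  both are treated as nets governed by a set \<open>R\<close> of rates, and each property is proved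
  once for \<open>R\<close>. And classes are unions over representatives while the integral is a
  definite description over all local choices \<open>O1\<close>, \<open>W\<close>; this layer is
  collapsed to a single integral of a single representative whenever one set \<open>W0\<close>
  captures the support over all of \<open>X\<close>.\<close>

section \<open>Partial derivatives and smoothness\<close>

lemma iter_partial_simps:
  "iter_partial [] f = f"
  "iter_partial (b # bs) f = partial_deriv b (iter_partial bs f)"
  "iter_partial (bs @ [b]) f = iter_partial bs (partial_deriv b f)"
  by (simp_all add: iter_partial_def)

text \<open>Chain rule along the line through \<open>x\<close> in direction \<open>b\<close>. It
  lets every later computation run in the calculus of \<open>has_derivative\<close>.\<close>

lemma partial_deriv_eq:
  assumes "(f has_derivative D) (at x)"
  shows "partial_deriv b f x = D b"
proof -
  have "((\<lambda>t. f (x + t *\<^sub>R b)) has_derivative (\<lambda>t. D (t *\<^sub>R b))) (at 0)"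
    by (rule has_derivative_compose[where f="\<lambda>t. x + t *\<^sub>R b" and g=f and g'=D and x=0, simplified])
       (auto intro!: derivative_eq_intros assms)
  moreover have "D (t *\<^sub>R b) = t *\<^sub>R D b" for t
    using assms has_derivative_bounded_linear linear_simps(5) by blast
  ultimately have "((\<lambda>t. f (x + t *\<^sub>R b)) has_vector_derivative D b) (at 0)"
    by (simp add: has_vector_derivative_def)
  then show ?thesis
    unfolding partial_deriv_def by (rule vector_derivative_at)
qed

text \<open>Values of nets off \<open>\<Omega>\<close> are arbitrary, so functions are only ever
  known to agree on an open set; the line through \<open>x\<close> stays in that set for small
  \<open>t\<close>.\<close>

lemma partial_deriv_cong:
  assumes "open \<Omega>" "x \<in> \<Omega>" "\<And>y. y \<in> \<Omega> \<Longrightarrow> f y = g y"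
  shows "partial_deriv b f x = partial_deriv b g x"
proof -
  have "open ((\<lambda>t. x + t *\<^sub>R b) -` \<Omega>)"
    by (intro open_vimage assms continuous_intros)
  then have ev: "\<forall>\<^sub>F t in nhds 0. x + t *\<^sub>R b \<in> \<Omega>"
    using assms(2) unfolding eventually_nhds by (intro exI[of _ "(\<lambda>t. x + t *\<^sub>R b) -` \<Omega>"]) auto
  show ?thesis unfolding partial_deriv_def
    by (rule vector_derivative_cong_eq)
       (use ev assms(3) in \<open>auto elim!: eventually_mono\<close>)
qed

lemma differentiable_cong_open:
  assumes "open \<Omega>" "x \<in> \<Omega>" "\<And>y. y \<in> \<Omega> \<Longrightarrow> f y = g y" "g differentiable (at x)"
  shows "f differentiable (at x)"
  using assms unfolding differentiable_def
  by (metis has_derivative_transform_within_open)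

lemma smooth_on_continuous:
  assumes "smooth_on \<Omega> f" "set bs \<subseteq> Basis"
  shows "continuous_on \<Omega> (iter_partial bs f)"
  using assms unfolding smooth_on_def
  by (auto intro!: continuous_at_imp_continuous_on differentiable_imp_continuous_within)

lemma smooth_on_continuous0: "smooth_on \<Omega> f \<Longrightarrow> continuous_on \<Omega> f"
  using smooth_on_continuous[of \<Omega> f "[]"] by (simp add: iter_partial_simps)

lemma smooth_on_differentiable: "smooth_on \<Omega> f \<Longrightarrow> x \<in> \<Omega> \<Longrightarrow> f differentiable (at x)"
  unfolding smooth_on_def by (drule spec[of _ "[]"]) (simp add: iter_partial_simps)

lemma smooth_on_partial_deriv:
  assumes "smooth_on \<Omega> f" "b \<in> Basis" shows "smooth_on \<Omega> (partial_deriv b f)"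
  unfolding smooth_on_def
proof (intro allI impI)
  fix bs :: "'a list" assume "set bs \<subseteq> Basis"
  then show "\<forall>x\<in>\<Omega>. iter_partial bs (partial_deriv b f) differentiable (at x)"
    using assms unfolding smooth_on_def by (auto dest!: spec[of _ "bs @ [b]"] simp: iter_partial_simps)
qed

text \<open>Linearity of the derivative and expansion in the basis. The explicit form turns bounds
  on partial derivatives into bounds on the operator norm.\<close>

lemma smooth_on_has_derivative:
  assumes "smooth_on \<Omega> f" "x \<in> \<Omega>"
  shows "(f has_derivative (\<lambda>h. \<Sum>b\<in>Basis. (h \<bullet> b) *\<^sub>R partial_deriv b f x)) (at x)"
proof -
  obtain D where D: "(f has_derivative D) (at x)"
    using smooth_on_differentiable[OF assms] unfolding differentiable_def by blast
  then have lin: "linear D"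
    using has_derivative_bounded_linear bounded_linear.linear by blast
  have "D = (\<lambda>h. \<Sum>b\<in>Basis. (h \<bullet> b) *\<^sub>R partial_deriv b f x)"
  proof
    fix h
    have "D h = D (\<Sum>b\<in>Basis. (h \<bullet> b) *\<^sub>R b)"
      by (simp add: euclidean_representation)
    also have "\<dots> = (\<Sum>b\<in>Basis. (h \<bullet> b) *\<^sub>R D b)"
      by (simp add: linear_sum[OF lin] linear_cmul[OF lin])
    finally show "D h = (\<Sum>b\<in>Basis. (h \<bullet> b) *\<^sub>R partial_deriv b f x)"
      by (simp add: partial_deriv_eq[OF D])
  qed
  with D show ?thesis by simp
qed

section \<open>Nets of a given rate\<close>

definition moderate_rates :: "(real \<Rightarrow> real) set" where
  "moderate_rates = {s. \<exists>n::nat. s \<in> O[at_right 0](\<lambda>\<epsilon>. 1 / \<epsilon> ^ n)}"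

definition negligible_rates :: "(real \<Rightarrow> real) set" where
  "negligible_rates = {s. \<forall>n::nat. s \<in> O[at_right 0](\<lambda>\<epsilon>. \<epsilon> ^ n)}"

text \<open>What the two sets of rates share: each is a module over the moderate rates and is closed
  under eventual domination. The last clause allows any convenient majorant to stand in for an exact
  supremum.\<close>

definition rate_ideal :: "(real \<Rightarrow> real) set \<Rightarrow> bool" where
  "rate_ideal R \<longleftrightarrow> (\<lambda>\<epsilon>. 0) \<in> R \<and> (\<forall>s\<in>R. \<forall>t\<in>R. (\<lambda>\<epsilon>. s \<epsilon> + t \<epsilon>) \<in> R) \<and>
     (\<forall>s\<in>moderate_rates. \<forall>t\<in>R. (\<lambda>\<epsilon>. s \<epsilon> * t \<epsilon>) \<in> R) \<and>
     (\<forall>s. \<forall>t\<in>R. (\<forall>\<^sub>F \<epsilon> in at_right 0. \<bar>s \<epsilon>\<bar> \<le> \<bar>t \<epsilon>\<bar>) \<longrightarrow> s \<in> R)"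

lemma eventually_unit: "\<forall>\<^sub>F \<epsilon> in at_right (0::real). 0 < \<epsilon> \<and> \<epsilon> \<le> 1"
  unfolding eventually_at_right_field by (intro exI[of _ 1]) auto

lemma moderate_ratesD:
  assumes "s \<in> moderate_rates"
  obtains C n where "C > 0" "\<forall>\<^sub>F \<epsilon> in at_right 0. \<bar>s \<epsilon>\<bar> \<le> C / \<epsilon> ^ n"
proof -
  obtain n where "s \<in> O[at_right 0](\<lambda>\<epsilon>. 1 / \<epsilon> ^ n)"
    using assms unfolding moderate_rates_def by blast
  then obtain C where C: "C > 0" "\<forall>\<^sub>F \<epsilon> in at_right 0. norm (s \<epsilon>) \<le> C * norm (1 / \<epsilon> ^ n)"
    by (elim landau_o.bigE)
  have "\<forall>\<^sub>F \<epsilon> in at_right 0. \<bar>s \<epsilon>\<bar> \<le> C / \<epsilon> ^ n"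
    using C(2) eventually_unit by eventually_elim simp
  with C(1) that show thesis by blast
qed

lemma negligible_ratesD:
  fixes n :: nat
  assumes "s \<in> negligible_rates"
  obtains C where "C > 0" "\<forall>\<^sub>F \<epsilon> in at_right 0. \<bar>s \<epsilon>\<bar> \<le> C * \<epsilon> ^ n"
proof -
  have "s \<in> O[at_right 0](\<lambda>\<epsilon>. \<epsilon> ^ n)"
    using assms unfolding negligible_rates_def by blast
  then obtain C where C: "C > 0" "\<forall>\<^sub>F \<epsilon> in at_right 0. norm (s \<epsilon>) \<le> C * norm (\<epsilon> ^ n)"
    by (elim landau_o.bigE)
  have "\<forall>\<^sub>F \<epsilon> in at_right 0. \<bar>s \<epsilon>\<bar> \<le> C * \<epsilon> ^ n"
    using C(2) eventually_unit by eventually_elim simp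
  with C(1) that show thesis by blast
qed

lemma moderate_ratesI:
  assumes "\<forall>\<^sub>F \<epsilon> in at_right 0. \<bar>s \<epsilon>\<bar> \<le> C / \<epsilon> ^ n"
  shows "s \<in> moderate_rates"
proof -
  have "\<forall>\<^sub>F \<epsilon> in at_right 0. norm (s \<epsilon>) \<le> C * norm (1 / \<epsilon> ^ n)"
    using assms eventually_unit by eventually_elim simp
  then show ?thesis
    unfolding moderate_rates_def by (blast intro: bigoI)
qed

lemma negligible_ratesI:
  assumes "\<And>n::nat. \<exists>C. \<forall>\<^sub>F \<epsilon> in at_right 0. \<bar>s \<epsilon>\<bar> \<le> C * \<epsilon> ^ n"
  shows "s \<in> negligible_rates"
  unfolding negligible_rates_def
proof (intro CollectI allI)
  fix n
  obtain C where C: "\<forall>\<^sub>F \<epsilon> in at_right 0. \<bar>s \<epsilon>\<bar> \<le> C * \<epsilon> ^ n" using assms by blast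
  have "\<forall>\<^sub>F \<epsilon> in at_right 0. norm (s \<epsilon>) \<le> C * norm (\<epsilon> ^ n)"
    using C eventually_unit by eventually_elim simp
  then show "s \<in> O[at_right 0](\<lambda>\<epsilon>. \<epsilon> ^ n)" by (rule bigoI)
qed

lemma moderate_rates_const: "(\<lambda>\<epsilon>. c) \<in> moderate_rates"
  by (rule moderate_ratesI[of _ "\<bar>c\<bar>" 0]) simp

lemma rate_ideal_moderate: "rate_ideal moderate_rates"
  unfolding rate_ideal_def
proof (intro conjI ballI allI impI)
  fix s t assume s: "s \<in> moderate_rates" and t: "t \<in> moderate_rates"
  obtain C n where C: "C > 0" "\<forall>\<^sub>F \<epsilon> in at_right 0. \<bar>s \<epsilon>\<bar> \<le> C / \<epsilon> ^ n"
    using moderate_ratesD[OF s] by blast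
  obtain D m where D: "D > 0" "\<forall>\<^sub>F \<epsilon> in at_right 0. \<bar>t \<epsilon>\<bar> \<le> D / \<epsilon> ^ m"
    using moderate_ratesD[OF t] by blast
  \<comment> \<open>As \<open>\<epsilon> \<le> 1\<close>, raising either exponent to
    \<open>n + m\<close> only weakens the bound.\<close>
  have "\<forall>\<^sub>F \<epsilon> in at_right 0. \<bar>s \<epsilon> + t \<epsilon>\<bar> \<le> (C + D) / \<epsilon> ^ (n + m)"
    using C(2) D(2) eventually_unit
  proof eventually_elim
    case (elim \<epsilon>)
    have "C / \<epsilon> ^ n \<le> C / \<epsilon> ^ (n + m)" "D / \<epsilon> ^ m \<le> D / \<epsilon> ^ (n + m)"
      using elim C(1) D(1) by (auto intro!: divide_left_mono power_decreasing)
    then show ?case using elim by (simp add: add_divide_distrib)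
  qed
  then show "(\<lambda>\<epsilon>. s \<epsilon> + t \<epsilon>) \<in> moderate_rates" by (rule moderate_ratesI)
  have "\<forall>\<^sub>F \<epsilon> in at_right 0. \<bar>s \<epsilon> * t \<epsilon>\<bar> \<le> (C * D) / \<epsilon> ^ (n + m)"
    using C(2) D(2) eventually_unit
  proof eventually_elim
    case (elim \<epsilon>)
    have "\<bar>s \<epsilon>\<bar> * \<bar>t \<epsilon>\<bar> \<le> C / \<epsilon> ^ n * (D / \<epsilon> ^ m)"
      using elim C(1) by (intro mult_mono) auto
    then show ?case by (simp add: abs_mult power_add)
  qed
  then show "(\<lambda>\<epsilon>. s \<epsilon> * t \<epsilon>) \<in> moderate_rates" by (rule moderate_ratesI)
next
  fix s t assume "t \<in> moderate_rates" and le: "\<forall>\<^sub>F \<epsilon> in at_right 0. \<bar>s \<epsilon>\<bar> \<le> \<bar>t \<epsilon>\<bar>"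
  then obtain C n where C: "C > 0" "\<forall>\<^sub>F \<epsilon> in at_right 0. \<bar>t \<epsilon>\<bar> \<le> C / \<epsilon> ^ n"
    using moderate_ratesD by metis
  have "\<forall>\<^sub>F \<epsilon> in at_right 0. \<bar>s \<epsilon>\<bar> \<le> C / \<epsilon> ^ n"
    using C(2) le by eventually_elim simp
  then show "s \<in> moderate_rates" by (rule moderate_ratesI)
qed (rule moderate_rates_const)

lemma rate_ideal_negligible: "rate_ideal negligible_rates"
  unfolding rate_ideal_def
proof (intro conjI ballI allI impI)
  show "(\<lambda>\<epsilon>. 0) \<in> negligible_rates" by (simp add: negligible_rates_def)
next
  fix s t assume "s \<in> negligible_rates" "t \<in> negligible_rates"
  then show "(\<lambda>\<epsilon>. s \<epsilon> + t \<epsilon>) \<in> negligible_rates"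
    unfolding negligible_rates_def by (auto intro: sum_in_bigo)
next
  fix s t assume s: "s \<in> moderate_rates" and t: "t \<in> negligible_rates"
  obtain C n where C: "C > 0" "\<forall>\<^sub>F \<epsilon> in at_right 0. \<bar>s \<epsilon>\<bar> \<le> C / \<epsilon> ^ n"
    using moderate_ratesD[OF s] by blast
  show "(\<lambda>\<epsilon>. s \<epsilon> * t \<epsilon>) \<in> negligible_rates"
  proof (rule negligible_ratesI)
    fix m
    \<comment> \<open>The extra \<open>n\<close> pays for the growth
      \<open>C / \<epsilon> ^ n\<close> of the moderate factor.\<close>
    obtain D where D: "D > 0" "\<forall>\<^sub>F \<epsilon> in at_right 0. \<bar>t \<epsilon>\<bar> \<le> D * \<epsilon> ^ (n + m)"
      using negligible_ratesD[OF t] by blast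
    have "\<forall>\<^sub>F \<epsilon> in at_right 0. \<bar>s \<epsilon> * t \<epsilon>\<bar> \<le> (C * D) * \<epsilon> ^ m"
      using C(2) D(2) eventually_unit
    proof eventually_elim
      case (elim \<epsilon>)
      have "\<bar>s \<epsilon>\<bar> * \<bar>t \<epsilon>\<bar> \<le> C / \<epsilon> ^ n * (D * \<epsilon> ^ (n + m))"
        using elim C(1) by (intro mult_mono) auto
      also have "\<dots> = C * D * \<epsilon> ^ m" using elim by (simp add: power_add)
      finally show ?case by (simp add: abs_mult)
    qed
    then show "\<exists>C. \<forall>\<^sub>F \<epsilon> in at_right 0. \<bar>s \<epsilon> * t \<epsilon>\<bar> \<le> C * \<epsilon> ^ m" by blast
  qed
next
  fix s t assume t: "t \<in> negligible_rates" and le: "\<forall>\<^sub>F \<epsilon> in at_right 0. \<bar>s \<epsilon>\<bar> \<le> \<bar>t \<epsilon>\<bar>"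
  show "s \<in> negligible_rates"
  proof (rule negligible_ratesI)
    fix n
    obtain C where C: "\<forall>\<^sub>F \<epsilon> in at_right 0. \<bar>t \<epsilon>\<bar> \<le> C * \<epsilon> ^ n"
      using negligible_ratesD[OF t] by blast
    have "\<forall>\<^sub>F \<epsilon> in at_right 0. \<bar>s \<epsilon>\<bar> \<le> C * \<epsilon> ^ n"
      using C le by eventually_elim simp
    then show "\<exists>C. \<forall>\<^sub>F \<epsilon> in at_right 0. \<bar>s \<epsilon>\<bar> \<le> C * \<epsilon> ^ n" by blast
  qed
qed

lemma negligible_subset_moderate_rates: "negligible_rates \<subseteq> moderate_rates"
proof
  fix s assume "s \<in> negligible_rates"
  then obtain C where "\<forall>\<^sub>F \<epsilon> in at_right 0. \<bar>s \<epsilon>\<bar> \<le> C * \<epsilon> ^ 0"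
    by (rule negligible_ratesD)
  then show "s \<in> moderate_rates" by (intro moderate_ratesI[of _ C 0]) simp
qed

lemma rate_ideal_zero: "rate_ideal R \<Longrightarrow> (\<lambda>\<epsilon>. 0) \<in> R"
  and rate_ideal_add: "rate_ideal R \<Longrightarrow> s \<in> R \<Longrightarrow> t \<in> R \<Longrightarrow> (\<lambda>\<epsilon>. s \<epsilon> + t \<epsilon>) \<in> R"
  and rate_ideal_mult: "rate_ideal R \<Longrightarrow> s \<in> moderate_rates \<Longrightarrow> t \<in> R \<Longrightarrow> (\<lambda>\<epsilon>. s \<epsilon> * t \<epsilon>) \<in> R"
  and rate_ideal_dominated:
    "rate_ideal R \<Longrightarrow> t \<in> R \<Longrightarrow> (\<forall>\<^sub>F \<epsilon> in at_right 0. \<bar>s \<epsilon>\<bar> \<le> \<bar>t \<epsilon>\<bar>) \<Longrightarrow> s \<in> R"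
  unfolding rate_ideal_def by blast+

lemma rate_ideal_abs: "rate_ideal R \<Longrightarrow> s \<in> R \<Longrightarrow> (\<lambda>\<epsilon>. \<bar>s \<epsilon>\<bar>) \<in> R"
  by (rule rate_ideal_dominated) auto

lemma rate_ideal_sum:
  assumes "rate_ideal R" "finite I" "\<And>i. i \<in> I \<Longrightarrow> s i \<in> R"
  shows "(\<lambda>\<epsilon>. \<Sum>i\<in>I. s i \<epsilon>) \<in> R"
  using assms(2,3)
  by (induction I rule: finite_induct)
     (auto simp: rate_ideal_zero[OF assms(1)] intro!: rate_ideal_add[OF assms(1)])

definition nets_of_rate :: "(real \<Rightarrow> real) set \<Rightarrow> 'a::euclidean_space set \<Rightarrow> 'a net set" where
  "nets_of_rate R \<Omega> = {u. (\<forall>\<epsilon>\<in>{0<..1}. smooth_on \<Omega> (u \<epsilon>)) \<and>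
     (\<forall>K l. compact K \<and> K \<subseteq> \<Omega> \<longrightarrow> (\<lambda>\<epsilon>. seminorm_p K l (u \<epsilon>)) \<in> R)}"

lemma moderate_nets_eq: "moderate_nets \<Omega> = nets_of_rate moderate_rates \<Omega>"
  by (simp add: moderate_nets_def nets_of_rate_def moderate_rates_def)

lemma negligible_nets_eq: "negligible_nets \<Omega> = nets_of_rate negligible_rates \<Omega>"
  by (simp add: negligible_nets_def nets_of_rate_def negligible_rates_def)

lemma nets_of_rate_mono:
  assumes "u \<in> nets_of_rate R \<Omega>" "\<Omega>' \<subseteq> \<Omega>"
  shows "u \<in> nets_of_rate R \<Omega>'"
proof -
  have "smooth_on \<Omega>' (u \<epsilon>)" if "\<epsilon> \<in> {0<..1}" for \<epsilon>
    using assms that unfolding nets_of_rate_def smooth_on_def by blast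
  then show ?thesis using assms unfolding nets_of_rate_def by blast
qed

lemma negligible_subset_moderate_nets:
  "nets_of_rate negligible_rates \<Omega> \<subseteq> nets_of_rate moderate_rates \<Omega>"
  using negligible_subset_moderate_rates unfolding nets_of_rate_def by blast

section \<open>Uniform bounds and their localisation\<close>

text \<open>A majorant is asked for rather than the supremum, so nothing has to be known about
  finiteness and \<open>K\<close> may be any set, in particular an open ball of a cover.\<close>

definition bounded_at_rate ::
  "(real \<Rightarrow> real) set \<Rightarrow> 'a set \<Rightarrow> 'a::euclidean_space net \<Rightarrow> bool" where
  "bounded_at_rate R K u \<longleftrightarrow> (\<exists>s\<in>R. \<forall>\<^sub>F \<epsilon> in at_right 0. \<forall>x\<in>K. cmod (u \<epsilon> x) \<le> s \<epsilon>)"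

lemma seminorm_p_set_eq:
  "{cmod (iter_partial bs f x) | x bs. x \<in> K \<and> set bs \<subseteq> Basis \<and> length bs \<le> l}
    = (\<Union>bs\<in>{bs. set bs \<subseteq> Basis \<and> length bs \<le> l}. (\<lambda>x. cmod (iter_partial bs f x)) ` K)"
  by blast

text \<open>\<open>Sup\<close> on the reals is an upper bound only for bounded sets. Here the set is
  a finite union, over words of length at most \<open>l\<close>, of continuous images of the compact
  \<open>K\<close>.\<close>

lemma le_seminorm_p:
  assumes "smooth_on \<Omega> f" "compact K" "K \<subseteq> \<Omega>" "x \<in> K" "set bs \<subseteq> Basis" "length bs \<le> l"
  shows "cmod (iter_partial bs f x) \<le> seminorm_p K l f"
proof -
  have "bdd_above ((\<lambda>x. cmod (iter_partial bs f x)) ` K)" if "set bs \<subseteq> Basis" for bs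
  proof -
    have "continuous_on K (\<lambda>x. cmod (iter_partial bs f x))"
      using smooth_on_continuous[OF assms(1) that] assms(3)
      by (intro continuous_intros) (rule continuous_on_subset)
    then show ?thesis
      using assms(2) by (intro bounded_imp_bdd_above compact_imp_bounded compact_continuous_image)
  qed
  then have "bdd_above {cmod (iter_partial bs f x) | x bs.
      x \<in> K \<and> set bs \<subseteq> Basis \<and> length bs \<le> l}"
    unfolding seminorm_p_set_eq by (subst bdd_above_UN) (auto intro: finite_lists_length_le)
  then show ?thesis unfolding seminorm_p_def
    using assms(4-) by (intro cSup_upper) auto
qed

lemma seminorm_p_nonneg:
  assumes "smooth_on \<Omega> f" "compact K" "K \<subseteq> \<Omega>"
  shows "0 \<le> seminorm_p K l f"
proof (cases "K = {}")
  case False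
  then obtain x where "x \<in> K" by blast
  then show ?thesis
    using le_seminorm_p[OF assms, of x "[]" l] order_trans[OF norm_ge_zero] by simp
qed (simp add: seminorm_p_def)

lemma seminorm_p_le:
  assumes "0 \<le> B" "\<And>x bs. \<lbrakk>x \<in> K; set bs \<subseteq> Basis; length bs \<le> l\<rbrakk> \<Longrightarrow> cmod (iter_partial bs f x) \<le> B"
  shows "seminorm_p K l f \<le> B"
  unfolding seminorm_p_def using assms by (intro cSup_least) auto

text \<open>Only finitely many words have length at most \<open>l\<close>, so a bound for each word
  separately controls the seminorm. This replaces seminorms by pointwise estimates of single
  functions.\<close>

lemma nets_of_rate_iff:
  assumes "rate_ideal R"
  shows "u \<in> nets_of_rate R \<Omega> \<longleftrightarrow> (\<forall>\<epsilon>\<in>{0<..1}. smooth_on \<Omega> (u \<epsilon>)) \<and>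
    (\<forall>K bs. compact K \<and> K \<subseteq> \<Omega> \<and> set bs \<subseteq> Basis \<longrightarrow>
       bounded_at_rate R K (\<lambda>\<epsilon>. iter_partial bs (u \<epsilon>)))" (is "_ \<longleftrightarrow> ?sm \<and> ?bd")
proof
  assume u: "u \<in> nets_of_rate R \<Omega>"
  then have sm: ?sm unfolding nets_of_rate_def by blast
  moreover have ?bd
  proof (intro allI impI)
    fix K and bs :: "'a list" assume *: "compact K \<and> K \<subseteq> \<Omega> \<and> set bs \<subseteq> Basis"
    show "bounded_at_rate R K (\<lambda>\<epsilon>. iter_partial bs (u \<epsilon>))"
      unfolding bounded_at_rate_def
    proof (intro bexI)
      show "\<forall>\<^sub>F \<epsilon> in at_right 0. \<forall>x\<in>K.
          cmod (iter_partial bs (u \<epsilon>) x) \<le> seminorm_p K (length bs) (u \<epsilon>)"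
        using eventually_unit
        by eventually_elim (use sm * in \<open>auto intro: le_seminorm_p\<close>)
    qed (use u * in \<open>auto simp: nets_of_rate_def\<close>)
  qed
  ultimately show "?sm \<and> ?bd" ..
next
  assume asm: "?sm \<and> ?bd"
  have "(\<lambda>\<epsilon>. seminorm_p K l (u \<epsilon>)) \<in> R" if K: "compact K" "K \<subseteq> \<Omega>" for K l
  proof -
    let ?L = "{bs :: 'a list. set bs \<subseteq> Basis \<and> length bs \<le> l}"
    have fin: "finite ?L" by (auto intro: finite_lists_length_le)
    have "\<forall>bs\<in>?L. \<exists>s\<in>R. \<forall>\<^sub>F \<epsilon> in at_right 0. \<forall>x\<in>K. cmod (iter_partial bs (u \<epsilon>) x) \<le> s \<epsilon>"
      using asm K unfolding bounded_at_rate_def by blast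
    then obtain s where "\<forall>bs\<in>?L. s bs \<in> R \<and>
        (\<forall>\<^sub>F \<epsilon> in at_right 0. \<forall>x\<in>K. cmod (iter_partial bs (u \<epsilon>) x) \<le> s bs \<epsilon>)"
      unfolding Bex_def by (meson bchoice)
    then have s: "\<And>bs. bs \<in> ?L \<Longrightarrow> s bs \<in> R" "\<And>bs. bs \<in> ?L \<Longrightarrow>
        \<forall>\<^sub>F \<epsilon> in at_right 0. \<forall>x\<in>K. cmod (iter_partial bs (u \<epsilon>) x) \<le> s bs \<epsilon>"
      by blast+
    \<comment> \<open>The sum serves as one majorant for all words; the absolute values ensure that
      each summand is below the sum.\<close>
    have "(\<lambda>\<epsilon>. \<Sum>bs\<in>?L. \<bar>s bs \<epsilon>\<bar>) \<in> R"
      by (intro rate_ideal_sum assms fin rate_ideal_abs s)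
    moreover have "\<forall>\<^sub>F \<epsilon> in at_right 0. \<forall>bs\<in>?L. \<forall>x\<in>K. cmod (iter_partial bs (u \<epsilon>) x) \<le> s bs \<epsilon>"
      using s(2) by (intro eventually_ball_finite fin) blast
    then have "\<forall>\<^sub>F \<epsilon> in at_right 0. \<bar>seminorm_p K l (u \<epsilon>)\<bar> \<le> \<bar>\<Sum>bs\<in>?L. \<bar>s bs \<epsilon>\<bar>\<bar>"
      using eventually_unit
    proof eventually_elim
      case (elim \<epsilon>)
      have "seminorm_p K l (u \<epsilon>) \<le> (\<Sum>bs\<in>?L. \<bar>s bs \<epsilon>\<bar>)"
      proof (rule seminorm_p_le)
        fix x and bs :: "'a list" assume *: "x \<in> K" "set bs \<subseteq> Basis" "length bs \<le> l"
        then have "cmod (iter_partial bs (u \<epsilon>) x) \<le> \<bar>s bs \<epsilon>\<bar>" using elim(1) by fastforce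
        also have "\<dots> \<le> (\<Sum>bs\<in>?L. \<bar>s bs \<epsilon>\<bar>)"
          using * by (intro member_le_sum fin) auto
        finally show "cmod (iter_partial bs (u \<epsilon>) x) \<le> (\<Sum>bs\<in>?L. \<bar>s bs \<epsilon>\<bar>)" .
      qed (simp add: sum_nonneg)
      moreover have "0 \<le> seminorm_p K l (u \<epsilon>)"
        using asm elim K by (auto intro!: seminorm_p_nonneg)
      ultimately show ?case by simp
    qed
    ultimately show ?thesis by (rule rate_ideal_dominated[OF assms])
  qed
  then show "u \<in> nets_of_rate R \<Omega>" using asm unfolding nets_of_rate_def by blast
qed

lemma nets_of_rate_smooth: "u \<in> nets_of_rate R \<Omega> \<Longrightarrow> 0 < \<epsilon> \<Longrightarrow> \<epsilon> \<le> 1 \<Longrightarrow> smooth_on \<Omega> (u \<epsilon>)"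
  by (simp add: nets_of_rate_def)

lemma nets_of_rate_bounded:
  "rate_ideal R \<Longrightarrow> u \<in> nets_of_rate R \<Omega> \<Longrightarrow> compact K \<Longrightarrow> K \<subseteq> \<Omega> \<Longrightarrow> bounded_at_rate R K u"
  unfolding nets_of_rate_iff by (auto dest!: spec[of _ K] spec[of _ "[]"] simp: iter_partial_simps)

lemma nets_of_rate_partial_deriv:
  assumes "rate_ideal R" "u \<in> nets_of_rate R \<Omega>" "b \<in> Basis"
  shows "(\<lambda>\<epsilon>. partial_deriv b (u \<epsilon>)) \<in> nets_of_rate R \<Omega>"
  unfolding nets_of_rate_iff[OF assms(1)]
proof (intro conjI ballI allI impI)
  fix \<epsilon> :: real assume "\<epsilon> \<in> {0<..1}"
  then show "smooth_on \<Omega> (partial_deriv b (u \<epsilon>))"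
    using assms by (auto intro!: smooth_on_partial_deriv nets_of_rate_smooth)
next
  fix K and bs :: "'a list" assume "compact K \<and> K \<subseteq> \<Omega> \<and> set bs \<subseteq> Basis"
  \<comment> \<open>The last letter of a word is the derivative applied first.\<close>
  then have "bounded_at_rate R K (\<lambda>\<epsilon>. iter_partial (bs @ [b]) (u \<epsilon>))"
    using assms(2,3) unfolding nets_of_rate_iff[OF assms(1)] by simp
  then show "bounded_at_rate R K (\<lambda>\<epsilon>. iter_partial bs (partial_deriv b (u \<epsilon>)))"
    by (simp add: iter_partial_simps)
qed

lemma bounded_at_rate_cong:
  assumes "bounded_at_rate R K u" "\<And>\<epsilon> x. 0 < \<epsilon> \<Longrightarrow> \<epsilon> \<le> 1 \<Longrightarrow> x \<in> K \<Longrightarrow> v \<epsilon> x = u \<epsilon> x"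
  shows "bounded_at_rate R K v"
proof -
  obtain s where s: "s \<in> R" "\<forall>\<^sub>F \<epsilon> in at_right 0. \<forall>x\<in>K. cmod (u \<epsilon> x) \<le> s \<epsilon>"
    using assms(1) unfolding bounded_at_rate_def by blast
  have "\<forall>\<^sub>F \<epsilon> in at_right 0. \<forall>x\<in>K. cmod (v \<epsilon> x) \<le> s \<epsilon>"
    using s(2) eventually_unit by eventually_elim (simp add: assms(2))
  with s(1) show ?thesis unfolding bounded_at_rate_def by blast
qed

text \<open>
  A class \<open>S\<close> which absorbs all terms arising from differentiation makes formulas for iterated partial
  derivatives (Leibniz rule, chain rule, differentiation under the integral) unnecessary.
\<close>

lemma nets_of_rate_coinduct:
  assumes R: "rate_ideal R" and \<Omega>: "open \<Omega>" and u: "u \<in> S"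
    and diff: "\<And>v \<epsilon> x. \<lbrakk>v \<in> S; 0 < \<epsilon>; \<epsilon> \<le> 1; x \<in> \<Omega>\<rbrakk> \<Longrightarrow> v \<epsilon> differentiable (at x)"
    and bd: "\<And>v K. \<lbrakk>v \<in> S; compact K; K \<subseteq> \<Omega>\<rbrakk> \<Longrightarrow> bounded_at_rate R K v"
    and step: "\<And>v b. \<lbrakk>v \<in> S; b \<in> Basis\<rbrakk> \<Longrightarrow>
      \<exists>w\<in>S. \<forall>\<epsilon> x. 0 < \<epsilon> \<longrightarrow> \<epsilon> \<le> 1 \<longrightarrow> x \<in> \<Omega> \<longrightarrow> partial_deriv b (v \<epsilon>) x = w \<epsilon> x"
  shows "u \<in> nets_of_rate R \<Omega>"
proof -
  \<comment> \<open>Agreement on the open set \<open>\<Omega>\<close> survives differentiation, so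
    every iterated derivative is represented there by a member of \<open>S\<close>, which brings its
    own differentiability and bounds.\<close>
  have *: "\<exists>w\<in>S. \<forall>\<epsilon> x. 0 < \<epsilon> \<longrightarrow> \<epsilon> \<le> 1 \<longrightarrow> x \<in> \<Omega> \<longrightarrow> iter_partial bs (u \<epsilon>) x = w \<epsilon> x"
    if "set bs \<subseteq> Basis" for bs
    using that
  proof (induction bs)
    case (Cons b bs)
    then obtain v where v: "v \<in> S" "\<And>\<epsilon> x. 0 < \<epsilon> \<Longrightarrow> \<epsilon> \<le> 1 \<Longrightarrow> x \<in> \<Omega> \<Longrightarrow> iter_partial bs (u \<epsilon>) x = v \<epsilon> x"
      by auto
    obtain w where w: "w \<in> S" "\<And>\<epsilon> x. 0 < \<epsilon> \<Longrightarrow> \<epsilon> \<le> 1 \<Longrightarrow> x \<in> \<Omega> \<Longrightarrow> partial_deriv b (v \<epsilon>) x = w \<epsilon> x"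
      using step[OF v(1), of b] Cons.prems by auto
    have "iter_partial (b # bs) (u \<epsilon>) x = w \<epsilon> x" if "0 < \<epsilon>" "\<epsilon> \<le> 1" "x \<in> \<Omega>" for \<epsilon> x
      using partial_deriv_cong[OF \<Omega> that(3), of "iter_partial bs (u \<epsilon>)" "v \<epsilon>"] v(2) w(2) that
      by (simp add: iter_partial_simps)
    with w(1) show ?case by blast
  qed (use u in \<open>auto simp: iter_partial_simps\<close>)
  show ?thesis unfolding nets_of_rate_iff[OF R]
  proof (intro conjI ballI allI impI)
    fix \<epsilon> :: real assume "\<epsilon> \<in> {0<..1}"
    then have e: "0 < \<epsilon>" "\<epsilon> \<le> 1" by auto
    show "smooth_on \<Omega> (u \<epsilon>)" unfolding smooth_on_def
    proof (intro allI impI ballI)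
      fix bs :: "'a list" and x assume "set bs \<subseteq> Basis" "x \<in> \<Omega>"
      with *[of bs] e show "iter_partial bs (u \<epsilon>) differentiable at x"
        using differentiable_cong_open[OF \<Omega>] diff by metis
    qed
  next
    fix K and bs :: "'a list" assume K: "compact K \<and> K \<subseteq> \<Omega> \<and> set bs \<subseteq> Basis"
    with *[of bs] obtain w where w: "w \<in> S" "\<And>\<epsilon> x. 0 < \<epsilon> \<Longrightarrow> \<epsilon> \<le> 1 \<Longrightarrow> x \<in> \<Omega> \<Longrightarrow> iter_partial bs (u \<epsilon>) x = w \<epsilon> x"
      by blast
    show "bounded_at_rate R K (\<lambda>\<epsilon>. iter_partial bs (u \<epsilon>))"
      by (rule bounded_at_rate_cong[OF bd[OF w(1)]]) (use K w(2) in auto)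
  qed
qed

lemma bounded_at_rateI:
  "s \<in> R \<Longrightarrow> \<forall>\<^sub>F \<epsilon> in at_right 0. \<forall>x\<in>K. cmod (u \<epsilon> x) \<le> s \<epsilon> \<Longrightarrow> bounded_at_rate R K u"
  unfolding bounded_at_rate_def by (rule bexI)

lemma bounded_at_rate_add:
  assumes "rate_ideal R" "bounded_at_rate R K u" "bounded_at_rate R K v"
  shows "bounded_at_rate R K (\<lambda>\<epsilon> x. u \<epsilon> x + v \<epsilon> x)"
proof -
  obtain s t where s: "s \<in> R" "\<forall>\<^sub>F \<epsilon> in at_right 0. \<forall>x\<in>K. cmod (u \<epsilon> x) \<le> s \<epsilon>"
    and t: "t \<in> R" "\<forall>\<^sub>F \<epsilon> in at_right 0. \<forall>x\<in>K. cmod (v \<epsilon> x) \<le> t \<epsilon>"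
    using assms unfolding bounded_at_rate_def by blast
  have "\<forall>\<^sub>F \<epsilon> in at_right 0. \<forall>x\<in>K. cmod (u \<epsilon> x + v \<epsilon> x) \<le> s \<epsilon> + t \<epsilon>"
    using s(2) t(2) by eventually_elim (meson add_mono norm_triangle_le)
  with rate_ideal_add[OF assms(1) s(1) t(1)] show ?thesis by (rule bounded_at_rateI)
qed

lemma bounded_at_rate_mult:
  assumes "rate_ideal R" "bounded_at_rate moderate_rates K u" "bounded_at_rate R K v"
  shows "bounded_at_rate R K (\<lambda>\<epsilon> x. u \<epsilon> x * v \<epsilon> x)"
proof -
  obtain s t where s: "s \<in> moderate_rates" "\<forall>\<^sub>F \<epsilon> in at_right 0. \<forall>x\<in>K. cmod (u \<epsilon> x) \<le> s \<epsilon>"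
    and t: "t \<in> R" "\<forall>\<^sub>F \<epsilon> in at_right 0. \<forall>x\<in>K. cmod (v \<epsilon> x) \<le> t \<epsilon>"
    using assms unfolding bounded_at_rate_def by blast
  have "\<forall>\<^sub>F \<epsilon> in at_right 0. \<forall>x\<in>K. cmod (u \<epsilon> x * v \<epsilon> x) \<le> s \<epsilon> * t \<epsilon>"
    using s(2) t(2)
  proof eventually_elim
    case (elim \<epsilon>)
    show ?case
    proof
      fix x assume "x \<in> K"
      then have "cmod (u \<epsilon> x) \<le> s \<epsilon>" "cmod (v \<epsilon> x) \<le> t \<epsilon>" using elim by auto
      then show "cmod (u \<epsilon> x * v \<epsilon> x) \<le> s \<epsilon> * t \<epsilon>"
        using order_trans[OF norm_ge_zero] by (auto simp: norm_mult intro!: mult_mono)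
    qed
  qed
  with rate_ideal_mult[OF assms(1) s(1) t(1)] show ?thesis by (rule bounded_at_rateI)
qed

lemma bounded_at_rate_subset:
  "bounded_at_rate R K u \<Longrightarrow> K' \<subseteq> K \<Longrightarrow> bounded_at_rate R K' u"
  unfolding bounded_at_rate_def by (auto elim!: eventually_mono intro!: bexI)

lemma bounded_at_rate_Un:
  assumes "rate_ideal R" "bounded_at_rate R K u" "bounded_at_rate R L u"
  shows "bounded_at_rate R (K \<union> L) u"
proof -
  obtain s t where s: "s \<in> R" "\<forall>\<^sub>F \<epsilon> in at_right 0. \<forall>x\<in>K. cmod (u \<epsilon> x) \<le> s \<epsilon>"
    and t: "t \<in> R" "\<forall>\<^sub>F \<epsilon> in at_right 0. \<forall>x\<in>L. cmod (u \<epsilon> x) \<le> t \<epsilon>"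
    using assms unfolding bounded_at_rate_def by blast
  \<comment> \<open>A majorant over an empty set may be negative, hence the absolute values.\<close>
  have "\<forall>\<^sub>F \<epsilon> in at_right 0. \<forall>x\<in>K \<union> L. cmod (u \<epsilon> x) \<le> \<bar>s \<epsilon>\<bar> + \<bar>t \<epsilon>\<bar>"
    using s(2) t(2)
  proof eventually_elim
    case (elim \<epsilon>)
    then show ?case by fastforce
  qed
  moreover have "(\<lambda>\<epsilon>. \<bar>s \<epsilon>\<bar> + \<bar>t \<epsilon>\<bar>) \<in> R"
    using assms s t by (intro rate_ideal_add rate_ideal_abs)
  ultimately show ?thesis by (rule bounded_at_rateI[rotated])
qed

text \<open>A finite subcover reduces the claim to finite unions; the empty union is bounded by the
  zero rate.\<close>

lemma bounded_at_rate_local: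
  assumes "rate_ideal R" "compact K" "\<And>x. x \<in> K \<Longrightarrow> \<exists>T. open T \<and> x \<in> T \<and> bounded_at_rate R T u"
  shows "bounded_at_rate R K u"
proof -
  have "K \<subseteq> \<Union>{T. open T \<and> bounded_at_rate R T u}" using assms(3) by blast
  then obtain \<T> where \<T>: "\<T> \<subseteq> {T. open T \<and> bounded_at_rate R T u}" "finite \<T>" "K \<subseteq> \<Union>\<T>"
    using compactE[OF assms(2)] by (metis (no_types, lifting) mem_Collect_eq)
  from \<T>(2,1) have "bounded_at_rate R (\<Union>\<T>) u"
  proof (induction \<T> rule: finite_induct)
    case empty
    then show ?case using rate_ideal_zero[OF assms(1)] by (auto simp: bounded_at_rate_def)
  next
    case (insert T \<T>)
    then show ?case by (auto intro: bounded_at_rate_Un[OF assms(1)])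
  qed
  then show ?thesis using \<T>(3) by (rule bounded_at_rate_subset)
qed

text \<open>For negligible rates this is the separation half of the sheaf property: a generalized
  function that vanishes locally vanishes.\<close>

lemma nets_of_rate_local:
  assumes R: "rate_ideal R" and loc: "\<And>x. x \<in> \<Omega> \<Longrightarrow> \<exists>V. open V \<and> x \<in> V \<and> u \<in> nets_of_rate R V"
  shows "u \<in> nets_of_rate R \<Omega>"
  unfolding nets_of_rate_iff[OF R]
proof (intro conjI ballI allI impI)
  fix \<epsilon> :: real assume "\<epsilon> \<in> {0<..1}"
  then show "smooth_on \<Omega> (u \<epsilon>)"
    using loc unfolding smooth_on_def nets_of_rate_def by blast
next
  fix K and bs :: "'a list" assume K: "compact K \<and> K \<subseteq> \<Omega> \<and> set bs \<subseteq> Basis"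
  show "bounded_at_rate R K (\<lambda>\<epsilon>. iter_partial bs (u \<epsilon>))"
  proof (rule bounded_at_rate_local[OF R])
    fix x assume "x \<in> K"
    then obtain V where V: "open V" "x \<in> V" "u \<in> nets_of_rate R V" using loc K by blast
    then obtain e where e: "e > 0" "cball x e \<subseteq> V" by (meson open_contains_cball)
    \<comment> \<open>Bounds are available on compact sets, whereas the covering argument wants open
      ones: a closed ball supplies the bound and its interior enters the cover.\<close>
    then have "bounded_at_rate R (cball x e) (\<lambda>\<epsilon>. iter_partial bs (u \<epsilon>))"
      using V(3) K unfolding nets_of_rate_iff[OF R] by simp
    then have "bounded_at_rate R (ball x e) (\<lambda>\<epsilon>. iter_partial bs (u \<epsilon>))"
      by (rule bounded_at_rate_subset) (rule ball_subset_cball)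
    with e(1) show "\<exists>T. open T \<and> x \<in> T \<and> bounded_at_rate R T (\<lambda>\<epsilon>. iter_partial bs (u \<epsilon>))"
      by (intro exI[of _ "ball x e"]) simp
  qed (use K in blast)
qed

lemma nets_of_rate_cong:
  assumes R: "rate_ideal R" and \<Omega>: "open \<Omega>" and u: "u \<in> nets_of_rate R \<Omega>"
    and eq: "\<And>\<epsilon> x. 0 < \<epsilon> \<Longrightarrow> \<epsilon> \<le> 1 \<Longrightarrow> x \<in> \<Omega> \<Longrightarrow> v \<epsilon> x = u \<epsilon> x"
  shows "v \<in> nets_of_rate R \<Omega>"
proof (rule nets_of_rate_coinduct[OF R \<Omega>])
  \<comment> \<open>After one derivative \<open>v\<close> has been replaced by a derivative of
    \<open>u\<close>, so adding \<open>v\<close> alone closes the class.\<close>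
  let ?S = "insert v (nets_of_rate R \<Omega>)"
  have *: "\<exists>w\<in>nets_of_rate R \<Omega>. \<forall>\<epsilon> x. 0 < \<epsilon> \<longrightarrow> \<epsilon> \<le> 1 \<longrightarrow> x \<in> \<Omega> \<longrightarrow> z \<epsilon> x = w \<epsilon> x" if "z \<in> ?S" for z
    using that eq u by auto
  show "v \<in> ?S" by simp
  fix z assume z: "z \<in> ?S"
  obtain w where w: "w \<in> nets_of_rate R \<Omega>" "\<And>\<epsilon> x. 0 < \<epsilon> \<Longrightarrow> \<epsilon> \<le> 1 \<Longrightarrow> x \<in> \<Omega> \<Longrightarrow> z \<epsilon> x = w \<epsilon> x"
    using *[OF z] by blast
  show "z \<epsilon> differentiable (at x)" if "0 < \<epsilon>" "\<epsilon> \<le> 1" "x \<in> \<Omega>" for \<epsilon> x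
    by (rule differentiable_cong_open[OF \<Omega> that(3), of _ "w \<epsilon>"])
       (auto intro: w that smooth_on_differentiable nets_of_rate_smooth)
  show "bounded_at_rate R K z" if K: "compact K" "K \<subseteq> \<Omega>" for K
    by (rule bounded_at_rate_cong[OF nets_of_rate_bounded[OF R w(1) K]]) (use w(2) K in auto)
  show "\<exists>w\<in>?S. \<forall>\<epsilon> x. 0 < \<epsilon> \<longrightarrow> \<epsilon> \<le> 1 \<longrightarrow> x \<in> \<Omega> \<longrightarrow> partial_deriv b (z \<epsilon>) x = w \<epsilon> x"
    if "b \<in> Basis" for b
  proof (intro bexI allI impI)
    show "(\<lambda>\<epsilon>. partial_deriv b (w \<epsilon>)) \<in> ?S"
      using nets_of_rate_partial_deriv[OF R w(1) that] by simp
    fix \<epsilon> :: real and x assume "0 < \<epsilon>" "\<epsilon> \<le> 1" "x \<in> \<Omega>"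
    then show "partial_deriv b (z \<epsilon>) x = partial_deriv b (w \<epsilon>) x"
      using w(2) by (intro partial_deriv_cong[OF \<Omega>])
  qed
qed

lemma nets_of_rate_has_derivative:
  assumes "u \<in> nets_of_rate R \<Omega>" "0 < \<epsilon>" "\<epsilon> \<le> 1" "x \<in> \<Omega>"
  obtains D where "(u \<epsilon> has_derivative D) (at x)"
  using smooth_on_differentiable[OF nets_of_rate_smooth[OF assms(1-3)] assms(4)]
  unfolding differentiable_def by blast

section \<open>Closure under algebraic operations, conjugation and substitution\<close>

text \<open>The Leibniz rule leaves the set of products but stays among their sums, so this is the
  invariant class for multiplication. Only one factor carries the rate \<open>R\<close>; the other
  is moderate.\<close>

inductive_set sums_of_products ::
  "(real \<Rightarrow> real) set \<Rightarrow> 'a::euclidean_space set \<Rightarrow> 'a net set" for R \<Omega> where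
  product: "u \<in> nets_of_rate moderate_rates \<Omega> \<Longrightarrow> v \<in> nets_of_rate R \<Omega> \<Longrightarrow>
    (\<lambda>\<epsilon> x. u \<epsilon> x * v \<epsilon> x) \<in> sums_of_products R \<Omega>"
| sum: "u \<in> sums_of_products R \<Omega> \<Longrightarrow> v \<in> sums_of_products R \<Omega> \<Longrightarrow>
    (\<lambda>\<epsilon> x. u \<epsilon> x + v \<epsilon> x) \<in> sums_of_products R \<Omega>"

lemma sums_of_products_subset:
  assumes R: "rate_ideal R" and \<Omega>: "open \<Omega>"
  shows "sums_of_products R \<Omega> \<subseteq> nets_of_rate R \<Omega>"
proof
  fix u assume "u \<in> sums_of_products R \<Omega>"
  then show "u \<in> nets_of_rate R \<Omega>"
  proof (rule nets_of_rate_coinduct[OF R \<Omega>])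
    have diff: "z \<epsilon> differentiable (at x)"
      if "z \<in> sums_of_products R \<Omega>" "0 < \<epsilon>" "\<epsilon> \<le> 1" "x \<in> \<Omega>" for z \<epsilon> x
      using that
    proof (induction)
      case (product u v)
      then show ?case
        by (auto intro!: differentiable_mult intro: smooth_on_differentiable[OF nets_of_rate_smooth])
    qed auto
    then show "\<And>z \<epsilon> x. \<lbrakk>z \<in> sums_of_products R \<Omega>; 0 < \<epsilon>; \<epsilon> \<le> 1; x \<in> \<Omega>\<rbrakk> \<Longrightarrow> z \<epsilon> differentiable (at x)" .
    show "bounded_at_rate R K z"
      if "z \<in> sums_of_products R \<Omega>" "compact K" "K \<subseteq> \<Omega>" for z K
      using that
      by induction (auto intro!: bounded_at_rate_mult bounded_at_rate_add R
          intro: nets_of_rate_bounded rate_ideal_moderate)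
    show "\<exists>w\<in>sums_of_products R \<Omega>. \<forall>\<epsilon> x. 0 < \<epsilon> \<longrightarrow> \<epsilon> \<le> 1 \<longrightarrow> x \<in> \<Omega> \<longrightarrow> partial_deriv b (z \<epsilon>) x = w \<epsilon> x"
      if "z \<in> sums_of_products R \<Omega>" "b \<in> Basis" for z b
      using that
    proof (induction)
      case (product u v)
      let ?w = "\<lambda>\<epsilon> x. partial_deriv b (u \<epsilon>) x * v \<epsilon> x + u \<epsilon> x * partial_deriv b (v \<epsilon>) x"
      have "?w \<in> sums_of_products R \<Omega>"
        using product by (intro sums_of_products.intros nets_of_rate_partial_deriv R rate_ideal_moderate)
      moreover have "partial_deriv b (\<lambda>x. u \<epsilon> x * v \<epsilon> x) x = ?w \<epsilon> x" if e: "0 < \<epsilon>" "\<epsilon> \<le> 1" "x \<in> \<Omega>" for \<epsilon> x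
      proof -
        obtain D where D: "(u \<epsilon> has_derivative D) (at x)"
          by (rule nets_of_rate_has_derivative[OF product(1) e])
        obtain E where E: "(v \<epsilon> has_derivative E) (at x)"
          by (rule nets_of_rate_has_derivative[OF product(2) e])
        show ?thesis
          using partial_deriv_eq[OF has_derivative_mult[OF D E], of b]
          by (simp add: partial_deriv_eq[OF D] partial_deriv_eq[OF E])
      qed
      ultimately show ?case by (intro bexI[of _ ?w]) auto
    next
      case (sum u v)
      then obtain u' v' where u': "u' \<in> sums_of_products R \<Omega>"
          "\<And>\<epsilon> x. 0 < \<epsilon> \<Longrightarrow> \<epsilon> \<le> 1 \<Longrightarrow> x \<in> \<Omega> \<Longrightarrow> partial_deriv b (u \<epsilon>) x = u' \<epsilon> x"
        and v': "v' \<in> sums_of_products R \<Omega>"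
          "\<And>\<epsilon> x. 0 < \<epsilon> \<Longrightarrow> \<epsilon> \<le> 1 \<Longrightarrow> x \<in> \<Omega> \<Longrightarrow> partial_deriv b (v \<epsilon>) x = v' \<epsilon> x"
        by blast
      have "partial_deriv b (\<lambda>x. u \<epsilon> x + v \<epsilon> x) x = u' \<epsilon> x + v' \<epsilon> x" if e: "0 < \<epsilon>" "\<epsilon> \<le> 1" "x \<in> \<Omega>" for \<epsilon> x
      proof -
        obtain D E where D: "(u \<epsilon> has_derivative D) (at x)" and E: "(v \<epsilon> has_derivative E) (at x)"
          using diff[OF sum(1) e] diff[OF sum(2) e] unfolding differentiable_def by blast
        show ?thesis
          using partial_deriv_eq[OF has_derivative_add[OF D E], of b]
            partial_deriv_eq[OF D, of b] partial_deriv_eq[OF E, of b] u'(2)[OF e] v'(2)[OF e] by simp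
      qed
      moreover have "(\<lambda>\<epsilon> x. u' \<epsilon> x + v' \<epsilon> x) \<in> sums_of_products R \<Omega>"
        using u'(1) v'(1) by (rule sums_of_products.sum)
      ultimately show ?case by (intro bexI[of _ "\<lambda>\<epsilon> x. u' \<epsilon> x + v' \<epsilon> x"]) auto
    qed
  qed
qed

lemma nets_of_rate_mult:
  assumes "rate_ideal R" "open \<Omega>" "u \<in> nets_of_rate moderate_rates \<Omega>" "v \<in> nets_of_rate R \<Omega>"
  shows "(\<lambda>\<epsilon> x. u \<epsilon> x * v \<epsilon> x) \<in> nets_of_rate R \<Omega>"
  using sums_of_products_subset[OF assms(1,2)] sums_of_products.product[OF assms(3,4)] by blast

lemma partial_deriv_const: "partial_deriv b (\<lambda>x. c) x = 0"
  using partial_deriv_eq[OF has_derivative_const[of c "at x"], of b] by simp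

lemma nets_of_rate_const:
  assumes "open \<Omega>"
  shows "(\<lambda>\<epsilon> x. c) \<in> nets_of_rate moderate_rates \<Omega>"
proof (rule nets_of_rate_coinduct[OF rate_ideal_moderate assms])
  let ?S = "range (\<lambda>c (\<epsilon>::real) (x::'a). c :: complex)"
  show "(\<lambda>\<epsilon> x. c) \<in> ?S" by simp
  fix v assume v: "v \<in> ?S"
  then show "v \<epsilon> differentiable (at x)" for \<epsilon> x by auto
  show "bounded_at_rate moderate_rates K v" for K
    using v moderate_rates_const unfolding bounded_at_rate_def by force
  show "\<exists>w\<in>?S. \<forall>\<epsilon> x. 0 < \<epsilon> \<longrightarrow> \<epsilon> \<le> 1 \<longrightarrow> x \<in> \<Omega> \<longrightarrow> partial_deriv b (v \<epsilon>) x = w \<epsilon> x" for b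
    using v by (intro bexI[of _ "\<lambda>\<epsilon> x. 0"]) (auto simp: partial_deriv_const)
qed

lemma nets_of_rate_zero:
  assumes "rate_ideal R" "open \<Omega>"
  shows "(\<lambda>\<epsilon> x. 0) \<in> nets_of_rate R \<Omega>"
proof (rule nets_of_rate_coinduct[OF assms])
  let ?z = "\<lambda>(\<epsilon>::real) (x::'a). 0 :: complex"
  show "?z \<in> {?z}" by simp
  fix v assume v: "v \<in> {?z}"
  then show "v \<epsilon> differentiable (at x)" for \<epsilon> x by auto
  show "bounded_at_rate R K v" for K
    using v rate_ideal_zero[OF assms(1)] unfolding bounded_at_rate_def by force
  show "\<exists>w\<in>{?z}. \<forall>\<epsilon> x. 0 < \<epsilon> \<longrightarrow> \<epsilon> \<le> 1 \<longrightarrow> x \<in> \<Omega> \<longrightarrow> partial_deriv b (v \<epsilon>) x = w \<epsilon> x" for b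
    using v by (auto simp: partial_deriv_const)
qed

text \<open>Sums are obtained from the class built for products by taking the constant 1 as moderate
  factor.\<close>

lemma nets_of_rate_add:
  assumes "rate_ideal R" "open \<Omega>" "u \<in> nets_of_rate R \<Omega>" "v \<in> nets_of_rate R \<Omega>"
  shows "(\<lambda>\<epsilon> x. u \<epsilon> x + v \<epsilon> x) \<in> nets_of_rate R \<Omega>"
proof -
  have "(\<lambda>\<epsilon> x. 1 * u \<epsilon> x + 1 * v \<epsilon> x) \<in> sums_of_products R \<Omega>"
    by (intro sums_of_products.intros nets_of_rate_const assms)
  then show ?thesis using sums_of_products_subset[OF assms(1,2)] by auto
qed

lemma nets_of_rate_diff:
  assumes "rate_ideal R" "open \<Omega>" "u \<in> nets_of_rate R \<Omega>" "v \<in> nets_of_rate R \<Omega>"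
  shows "(\<lambda>\<epsilon> x. u \<epsilon> x - v \<epsilon> x) \<in> nets_of_rate R \<Omega>"
  using nets_of_rate_add[OF assms(1-3) nets_of_rate_mult[OF assms(1,2) nets_of_rate_const[OF assms(2)] assms(4), of "-1"]]
  by simp

text \<open>Conjugation is real linear and all derivatives here are along real directions, so the
  two commute.\<close>

lemma nets_of_rate_cnj:
  assumes "rate_ideal R" "open \<Omega>" "u \<in> nets_of_rate R \<Omega>"
  shows "(\<lambda>\<epsilon> x. cnj (u \<epsilon> x)) \<in> nets_of_rate R \<Omega>"
proof (rule nets_of_rate_coinduct[OF assms(1,2)])
  let ?S = "(\<lambda>u \<epsilon> x. cnj (u \<epsilon> x)) ` nets_of_rate R \<Omega>"
  show "(\<lambda>\<epsilon> x. cnj (u \<epsilon> x)) \<in> ?S" using assms by blast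
  fix z assume "z \<in> ?S"
  then obtain v where z: "z = (\<lambda>\<epsilon> x. cnj (v \<epsilon> x))" and v: "v \<in> nets_of_rate R \<Omega>" by blast
  have D: "(z \<epsilon> has_derivative (\<lambda>h. cnj (D h))) (at x)" if "(v \<epsilon> has_derivative D) (at x)" for \<epsilon> x D
    unfolding z using that by (rule bounded_linear.has_derivative[OF bounded_linear_cnj])
  show "z \<epsilon> differentiable (at x)" if "0 < \<epsilon>" "\<epsilon> \<le> 1" "x \<in> \<Omega>" for \<epsilon> x
    by (rule nets_of_rate_has_derivative[OF v that], drule D) (auto simp: differentiable_def)
  show "bounded_at_rate R K z" if "compact K" "K \<subseteq> \<Omega>" for K
    using nets_of_rate_bounded[OF assms(1) v that] unfolding bounded_at_rate_def z by simp
  show "\<exists>w\<in>?S. \<forall>\<epsilon> x. 0 < \<epsilon> \<longrightarrow> \<epsilon> \<le> 1 \<longrightarrow> x \<in> \<Omega> \<longrightarrow> partial_deriv b (z \<epsilon>) x = w \<epsilon> x" if b: "b \<in> Basis" for b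
  proof (intro bexI allI impI)
    show "(\<lambda>\<epsilon> x. cnj (partial_deriv b (v \<epsilon>) x)) \<in> ?S"
      by (rule image_eqI[OF _ nets_of_rate_partial_deriv[OF assms(1) v b]]) simp
    fix \<epsilon> :: real and x assume "0 < \<epsilon>" "\<epsilon> \<le> 1" "x \<in> \<Omega>"
    then obtain E where E: "(v \<epsilon> has_derivative E) (at x)" using nets_of_rate_has_derivative[OF v] by blast
    show "partial_deriv b (z \<epsilon>) x = cnj (partial_deriv b (v \<epsilon>) x)"
      by (simp add: partial_deriv_eq[OF D[OF E]] partial_deriv_eq[OF E])
  qed
qed

text \<open>If \<open>L\<close> sends basis vectors to basis vectors or 0, then a partial derivative
  of the composite is the composite of a partial derivative or 0, and no chain rule sums arise. The
  shift \<open>c\<close> may depend on \<open>\<epsilon>\<close>, which is why one compact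
  \<open>K'\<close> must catch the image of \<open>K\<close> for all \<open>\<epsilon>\<close>
  together.\<close>

lemma nets_of_rate_compose:
  fixes L :: "'a::euclidean_space \<Rightarrow> 'b::euclidean_space" and c :: "real \<Rightarrow> 'b"
  assumes R: "rate_ideal R" and \<Omega>: "open \<Omega>" and \<Omega>': "open \<Omega>'" and u: "u \<in> nets_of_rate R \<Omega>'"
    and L: "bounded_linear L" "\<And>b. b \<in> Basis \<Longrightarrow> L b \<in> Basis \<or> L b = 0"
    and K: "\<And>K. compact K \<Longrightarrow> K \<subseteq> \<Omega> \<Longrightarrow> \<exists>K'. compact K' \<and> K' \<subseteq> \<Omega>' \<and>
      (\<forall>\<epsilon> x. 0 < \<epsilon> \<longrightarrow> \<epsilon> \<le> 1 \<longrightarrow> x \<in> K \<longrightarrow> c \<epsilon> + L x \<in> K')"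
  shows "(\<lambda>\<epsilon> x. u \<epsilon> (c \<epsilon> + L x)) \<in> nets_of_rate R \<Omega>"
proof (rule nets_of_rate_coinduct[OF R \<Omega>])
  let ?S = "(\<lambda>u \<epsilon> x. u \<epsilon> (c \<epsilon> + L x)) ` nets_of_rate R \<Omega>'"
  show "(\<lambda>\<epsilon> x. u \<epsilon> (c \<epsilon> + L x)) \<in> ?S" using u by blast
  have in\<Omega>': "c \<epsilon> + L x \<in> \<Omega>'" if "0 < \<epsilon>" "\<epsilon> \<le> 1" "x \<in> \<Omega>" for \<epsilon> x
    using K[of "{x}"] that by auto
  fix z assume "z \<in> ?S"
  then obtain v where z: "z = (\<lambda>\<epsilon> x. v \<epsilon> (c \<epsilon> + L x))" and v: "v \<in> nets_of_rate R \<Omega>'" by blast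
  have D: "(z \<epsilon> has_derivative (\<lambda>h. D (L h))) (at x)"
    if "(v \<epsilon> has_derivative D) (at (c \<epsilon> + L x))" for \<epsilon> x D
    unfolding z using that
    by (rule has_derivative_compose[rotated])
       (auto intro!: derivative_eq_intros bounded_linear_imp_has_derivative[OF L(1)])
  show "z \<epsilon> differentiable (at x)" if "0 < \<epsilon>" "\<epsilon> \<le> 1" "x \<in> \<Omega>" for \<epsilon> x
    by (rule nets_of_rate_has_derivative[OF v that(1,2) in\<Omega>'[OF that]], drule D)
       (auto simp: differentiable_def)
  show "bounded_at_rate R K z" if K': "compact K" "K \<subseteq> \<Omega>" for K
  proof -
    obtain L' where L': "compact L'" "L' \<subseteq> \<Omega>'" "\<forall>\<epsilon> x. 0 < \<epsilon> \<longrightarrow> \<epsilon> \<le> 1 \<longrightarrow> x \<in> K \<longrightarrow> c \<epsilon> + L x \<in> L'"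
      using K[OF K'] by blast
    obtain s where s: "s \<in> R" "\<forall>\<^sub>F \<epsilon> in at_right 0. \<forall>x\<in>L'. cmod (v \<epsilon> x) \<le> s \<epsilon>"
      using nets_of_rate_bounded[OF R v L'(1,2)] unfolding bounded_at_rate_def by blast
    have "\<forall>\<^sub>F \<epsilon> in at_right 0. \<forall>x\<in>K. cmod (z \<epsilon> x) \<le> s \<epsilon>"
      using s(2) eventually_unit by eventually_elim (use L'(3) in \<open>auto simp: z\<close>)
    with s(1) show ?thesis unfolding bounded_at_rate_def by blast
  qed
  show "\<exists>w\<in>?S. \<forall>\<epsilon> x. 0 < \<epsilon> \<longrightarrow> \<epsilon> \<le> 1 \<longrightarrow> x \<in> \<Omega> \<longrightarrow> partial_deriv b (z \<epsilon>) x = w \<epsilon> x" if b: "b \<in> Basis" for b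
  proof (intro bexI allI impI)
    \<comment> \<open>The net spaces are known to be closed under derivatives along basis vectors
      only, so the direction 0 is treated apart.\<close>
    let ?v' = "\<lambda>\<epsilon>. if L b = 0 then (\<lambda>x. 0) else partial_deriv (L b) (v \<epsilon>)"
    have "?v' \<in> nets_of_rate R \<Omega>'"
      using nets_of_rate_partial_deriv[OF R v, of "L b"] L(2)[OF b] nets_of_rate_zero[OF R \<Omega>']
      by (cases "L b = 0") auto
    then show "(\<lambda>\<epsilon> x. ?v' \<epsilon> (c \<epsilon> + L x)) \<in> ?S" by (rule image_eqI[rotated]) (rule refl)
    fix \<epsilon> :: real and x assume e: "0 < \<epsilon>" "\<epsilon> \<le> 1" "x \<in> \<Omega>"
    then obtain E where E: "(v \<epsilon> has_derivative E) (at (c \<epsilon> + L x))"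
      using nets_of_rate_has_derivative[OF v] in\<Omega>' by blast
    then have "E 0 = 0" using has_derivative_bounded_linear linear_simps(3) by blast
    then show "partial_deriv b (z \<epsilon>) x = ?v' \<epsilon> (c \<epsilon> + L x)"
      by (simp add: partial_deriv_eq[OF D[OF E]] partial_deriv_eq[OF E])
  qed
qed

lemma nets_of_rate_snd:
  assumes R: "rate_ideal R" and XY: "open X" "open Y" and f: "f \<in> nets_of_rate R Y"
  shows "(\<lambda>\<epsilon> z. f \<epsilon> (snd z)) \<in> nets_of_rate R (X \<times> Y)"
proof -
  have "(\<lambda>\<epsilon> z. f \<epsilon> (0 + snd z)) \<in> nets_of_rate R (X \<times> Y)"
  proof (rule nets_of_rate_compose[OF R open_Times[OF XY] XY(2) f bounded_linear_snd])
    fix K assume "compact K" "K \<subseteq> X \<times> Y"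
    then show "\<exists>K'. compact K' \<and> K' \<subseteq> Y \<and> (\<forall>\<epsilon> x. 0 < \<epsilon> \<longrightarrow> \<epsilon> \<le> 1 \<longrightarrow> x \<in> K \<longrightarrow> 0 + snd x \<in> K')"
      by (intro exI[of _ "snd ` K"]) (auto intro!: compact_continuous_image continuous_intros)
  qed (auto simp: Basis_prod_def)
  then show ?thesis by simp
qed

text \<open>The base point may wander with \<open>\<epsilon>\<close> inside a compact set; this is
  what makes the section through the maximiser a net of the same rate.\<close>

lemma nets_of_rate_section:
  assumes R: "rate_ideal R" and XY: "open X" "open Y" and g: "g \<in> nets_of_rate R (X \<times> Y)"
    and K1: "compact K1" "K1 \<subseteq> X" "\<And>\<epsilon>. 0 < \<epsilon> \<Longrightarrow> \<epsilon> \<le> 1 \<Longrightarrow> p \<epsilon> \<in> K1"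
  shows "(\<lambda>\<epsilon> y. g \<epsilon> (p \<epsilon>, y)) \<in> nets_of_rate R Y"
proof -
  have "(\<lambda>\<epsilon> y. g \<epsilon> ((p \<epsilon>, 0) + (0, y))) \<in> nets_of_rate R Y"
  proof (rule nets_of_rate_compose[OF R XY(2) open_Times[OF XY] g])
    show "bounded_linear (\<lambda>y. (0, y) :: 'a \<times> 'b)"
      by (intro bounded_linear_Pair bounded_linear_zero bounded_linear_ident)
    fix K assume "compact K" "K \<subseteq> Y"
    then show "\<exists>K'. compact K' \<and> K' \<subseteq> X \<times> Y \<and>
        (\<forall>\<epsilon> x. 0 < \<epsilon> \<longrightarrow> \<epsilon> \<le> 1 \<longrightarrow> x \<in> K \<longrightarrow> (p \<epsilon>, 0) + (0, x) \<in> K')"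
      using K1 by (intro exI[of _ "K1 \<times> K"]) (auto intro!: compact_Times)
  qed (auto simp: Basis_prod_def)
  then show ?thesis by simp
qed

section \<open>Integration over a parameter\<close>

text \<open>The domain \<open>B\<close> is only Borel inside a compact set, because differences of
  open sets occur later as domains of integration.\<close>

lemma set_integrable_continuous:
  fixes f :: "'b::euclidean_space \<Rightarrow> 'c::{banach, second_countable_topology}"
  assumes "compact C" "continuous_on C f" "B \<in> sets borel" "B \<subseteq> C"
  shows "set_integrable lborel B f"
proof (rule set_integrable_subset)
  show "set_integrable lborel C f"
    unfolding set_integrable_def by (rule borel_integrable_compact[OF assms(1,2)])
qed (use assms in auto)

lemma norm_set_integral_le:
  fixes f :: "'b::euclidean_space \<Rightarrow> complex"
  assumes "compact C" "continuous_on C f" "B \<in> sets borel" "B \<subseteq> C" "0 \<le> M"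
    "\<And>y. y \<in> C \<Longrightarrow> cmod (f y) \<le> M"
  shows "cmod (LINT y:B|lborel. f y) \<le> M * measure lborel C"
proof -
  have "integrable lborel (indicator C :: 'b \<Rightarrow> real)"
    using emeasure_compact_finite[OF assms(1)] borel_compact[OF assms(1)] by simp
  then have "integrable lborel (\<lambda>y. M * indicator C y)" by simp
  then have "cmod (LINT y:B|lborel. f y) \<le> (\<integral>y. M * indicator C y \<partial>lborel)"
    unfolding set_lebesgue_integral_def
    using set_integrable_continuous[OF assms(1-4)] assms(4-6)
    by (intro Bochner_Integration.integral_norm_bound_integral)
       (auto simp: set_integrable_def split: split_indicator)
  then show ?thesis by simp
qed

text \<open>The basis of the product consists of vectors \<open>(b, 0)\<close> and
  \<open>(0, b)\<close>; the latter are orthogonal to the increment \<open>(h, 0)\<close>.\<close>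

lemma smooth_on_has_derivative_fst:
  assumes "smooth_on Z g" "(x, y) \<in> Z"
  shows "((\<lambda>x. g (x, y)) has_derivative
    (\<lambda>h. \<Sum>b\<in>Basis. (h \<bullet> b) *\<^sub>R partial_deriv (b, 0) g (x, y))) (at x)"
proof -
  have "((\<lambda>x. g (x, y)) has_derivative
      (\<lambda>h. \<Sum>b\<in>Basis. ((h, 0) \<bullet> b) *\<^sub>R partial_deriv b g (x, y))) (at x)"
    by (rule has_derivative_compose[where f = "\<lambda>x. (x, y)" and f' = "\<lambda>h. (h, 0)",
          OF _ smooth_on_has_derivative[OF assms]])
       (auto intro!: derivative_eq_intros)
  moreover have "(\<Sum>b\<in>Basis. ((h, 0) \<bullet> b) *\<^sub>R partial_deriv b g (x, y)) =
      (\<Sum>b\<in>Basis. (h \<bullet> b) *\<^sub>R partial_deriv (b, 0) g (x, y))" for h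
    unfolding Basis_prod_def
    by (subst sum.union_disjoint) (auto simp: sum.reindex inj_on_def)
  ultimately show ?thesis by simp
qed

text \<open>Uniform continuity of the partial derivatives on a compact product makes the first order
  remainder of \<open>g (_, y)\<close> small uniformly in \<open>y\<close>; integrating over a set
  of finite measure keeps it small.\<close>

lemma has_derivative_set_integral:
  fixes g :: "'a::euclidean_space \<times> 'b::euclidean_space \<Rightarrow> complex"
  assumes g: "smooth_on Z g" and X: "open X" "x \<in> X" and C: "compact C" "X \<times> C \<subseteq> Z"
    and B: "B \<in> sets borel" "B \<subseteq> C"
  shows "((\<lambda>x. LINT y:B|lborel. g (x, y)) has_derivative
    (\<lambda>h. \<Sum>b\<in>Basis. (h \<bullet> b) *\<^sub>R (LINT y:B|lborel. partial_deriv (b, 0) g (x, y)))) (at x)"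
  unfolding has_derivative_at_alt
proof (intro conjI allI impI)
  let ?P = "\<lambda>b z. partial_deriv (b, 0) g z"
  show "bounded_linear (\<lambda>h. \<Sum>b\<in>Basis. (h \<bullet> b) *\<^sub>R (LINT y:B|lborel. ?P b (x, y)))"
    by (intro bounded_linear_sum bounded_linear_scaleR_const bounded_linear_inner_left)
  fix e :: real assume e: "e > 0"
  obtain \<rho> where \<rho>: "\<rho> > 0" "cball x \<rho> \<subseteq> X" using X open_contains_cball by blast
  let ?Q = "cball x \<rho> \<times> C"
  have Q: "compact ?Q" "?Q \<subseteq> Z" using C \<rho> by (auto intro!: compact_Times)
  have contP: "continuous_on Z (?P b)" if "b \<in> Basis" for b
    by (rule smooth_on_continuous0[OF smooth_on_partial_deriv[OF g]]) (use that in \<open>simp add: Basis_prod_def\<close>)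
  \<comment> \<open>\<open>q\<close> bounds the operator norm of the change of the derivative
    between \<open>x\<close> and \<open>fst z\<close>. It vanishes at \<open>fst z = x\<close>, so
    its uniform continuity is a bound on \<open>q\<close> itself.\<close>
  define q where "q z = (\<Sum>b\<in>Basis. cmod (?P b z - ?P b (x, snd z)))" for z
  have "continuous_on ?Q q"
    unfolding q_def
    by (intro continuous_intros continuous_on_subset[OF contP]
        continuous_on_compose2[OF contP]) (use Q \<rho> in auto)
  then have "uniformly_continuous_on ?Q q" using Q(1) by (rule compact_uniformly_continuous)
  \<comment> \<open>The summand 1 avoids a division by 0 when \<open>C\<close> is a null
    set.\<close>
  moreover define e' where "e' = e / (1 + measure lborel C)"
  have e': "e' > 0" "e' * measure lborel C \<le> e"
    unfolding e'_def using e by (auto simp: field_simps add_pos_nonneg)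
  ultimately obtain \<delta> where \<delta>: "\<delta> > 0" "\<And>z z'. z \<in> ?Q \<Longrightarrow> z' \<in> ?Q \<Longrightarrow> dist z' z < \<delta> \<Longrightarrow> dist (q z') (q z) < e'"
    unfolding uniformly_continuous_on_def by blast
  define d where "d = min \<rho> \<delta>"
  have d: "d > 0" "d \<le> \<rho>" "d \<le> \<delta>" using \<rho> \<delta> by (auto simp: d_def)
  have q: "q (x', y) \<le> e'" if "x' \<in> ball x d" "y \<in> C" for x' y
  proof -
    have "dist (q (x', y)) (q (x, y)) < e'"
      by (rule \<delta>(2)) (use that d \<rho> in \<open>auto simp: dist_Pair_Pair dist_commute\<close>)
    then show ?thesis by (simp add: q_def dist_real_def)
  qed
  show "\<exists>d>0. \<forall>x'. norm (x' - x) < d \<longrightarrow>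
    cmod ((LINT y:B|lborel. g (x', y)) - (LINT y:B|lborel. g (x, y)) -
      (\<Sum>b\<in>Basis. ((x' - x) \<bullet> b) *\<^sub>R (LINT y:B|lborel. ?P b (x, y)))) \<le> e * norm (x' - x)"
  proof (intro exI conjI allI impI)
    show "d > 0" by fact
    fix x' assume "norm (x' - x) < d"
    then have x': "x' \<in> ball x d" by (simp add: dist_norm norm_minus_commute)
    have x'X: "x' \<in> X" using x' d \<rho> by auto
    let ?r = "\<lambda>y. g (x', y) - g (x, y) - (\<Sum>b\<in>Basis. ((x' - x) \<bullet> b) *\<^sub>R ?P b (x, y))"
    have r: "cmod (?r y) \<le> norm (x' - x) * e'" if y: "y \<in> C" for y
    proof (rule differentiable_bound_linearization[where S = "ball x d" and f = "\<lambda>x. g (x, y)" and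
          f' = "\<lambda>x h. \<Sum>b\<in>Basis. (h \<bullet> b) *\<^sub>R ?P b (x, y)" and ?x0.0 = x])
      show "x + t *\<^sub>R (x' - x) \<in> ball x d" if "t \<in> {0..1}" for t
      proof -
        have "norm (t *\<^sub>R (x' - x)) \<le> norm (x' - x)" using that by (simp add: mult_left_le_one_le)
        then show ?thesis using x' by (simp add: dist_norm norm_minus_commute)
      qed
      show "((\<lambda>x. g (x, y)) has_derivative (\<lambda>h. \<Sum>b\<in>Basis. (h \<bullet> b) *\<^sub>R ?P b (z, y))) (at z within ball x d)"
        if "z \<in> ball x d" for z
      proof -
        have "z \<in> X" using that \<rho>(2) d(2) by (auto simp: subset_iff)
        then show ?thesis
          using y C(2) by (intro has_derivative_at_withinI[OF smooth_on_has_derivative_fst[OF g]]) auto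
      qed
      show "onorm ((\<lambda>h. \<Sum>b\<in>Basis. (h \<bullet> b) *\<^sub>R ?P b (z, y)) - (\<lambda>h. \<Sum>b\<in>Basis. (h \<bullet> b) *\<^sub>R ?P b (x, y))) \<le> e'"
        if z: "z \<in> ball x d" for z
      proof (rule onorm_le)
        fix h :: 'a
        have "cmod (\<Sum>b\<in>Basis. (h \<bullet> b) *\<^sub>R (?P b (z, y) - ?P b (x, y))) \<le>
            (\<Sum>b\<in>Basis. norm h * cmod (?P b (z, y) - ?P b (x, y)))"
          by (intro sum_norm_le) (auto intro!: mult_right_mono Basis_le_norm)
        also have "\<dots> = norm h * q (z, y)" by (simp add: q_def sum_distrib_left)
        also have "\<dots> \<le> norm h * e'" using q[OF z y] by (intro mult_left_mono) auto
        finally show "cmod (((\<lambda>h. \<Sum>b\<in>Basis. (h \<bullet> b) *\<^sub>R ?P b (z, y)) -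
            (\<lambda>h. \<Sum>b\<in>Basis. (h \<bullet> b) *\<^sub>R ?P b (x, y))) h) \<le> e' * norm h"
          by (simp add: sum_subtractf scaleR_diff_right mult.commute)
      qed
    qed (use d in simp)
    have contg: "continuous_on C (\<lambda>y. g (z, y))" if "z \<in> X" for z
      by (rule continuous_on_compose2[OF smooth_on_continuous0[OF g]]) (use that C in \<open>auto intro!: continuous_intros\<close>)
    have contPx: "continuous_on C (\<lambda>y. ?P b (x, y))" if "b \<in> Basis" for b
      by (rule continuous_on_compose2[OF contP]) (use that C X in \<open>auto intro!: continuous_intros\<close>)
    have int: "set_integrable lborel B (\<lambda>y. g (x', y))" "set_integrable lborel B (\<lambda>y. g (x, y))"
      using contg x'X X by (auto intro!: set_integrable_continuous[OF C(1) _ B])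
    have intP: "set_integrable lborel B (\<lambda>y. ((x' - x) \<bullet> b) *\<^sub>R ?P b (x, y))" if "b \<in> Basis" for b
      using contPx[OF that] by (intro set_integrable_continuous[OF C(1) _ B] continuous_intros)
    have intS: "set_integrable lborel B (\<lambda>y. \<Sum>b\<in>Basis. ((x' - x) \<bullet> b) *\<^sub>R ?P b (x, y))"
      using contPx by (intro set_integrable_continuous[OF C(1) _ B] continuous_intros)
    have "(LINT y:B|lborel. \<Sum>b\<in>Basis. ((x' - x) \<bullet> b) *\<^sub>R ?P b (x, y)) =
        (\<Sum>b\<in>Basis. (LINT y:B|lborel. ((x' - x) \<bullet> b) *\<^sub>R ?P b (x, y)))"
      using intP unfolding set_lebesgue_integral_def set_integrable_def scaleR_sum_right
      by (intro Bochner_Integration.integral_sum)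
    then have "(LINT y:B|lborel. ?r y) = (LINT y:B|lborel. g (x', y)) - (LINT y:B|lborel. g (x, y)) -
      (\<Sum>b\<in>Basis. ((x' - x) \<bullet> b) *\<^sub>R (LINT y:B|lborel. ?P b (x, y)))"
      by (simp add: set_integral_diff[OF set_integral_diff(1)[OF int] intS] set_integral_diff[OF int])
    moreover have "cmod (LINT y:B|lborel. ?r y) \<le> (norm (x' - x) * e') * measure lborel C"
    proof (rule norm_set_integral_le[OF C(1) _ B])
      show "continuous_on C ?r"
        using contg x'X X contPx by (intro continuous_intros) auto
    qed (use r e' in auto)
    moreover have "norm (x' - x) * (e' * measure lborel C) \<le> norm (x' - x) * e"
      using e'(2) by (intro mult_left_mono) auto
    ultimately show "cmod ((LINT y:B|lborel. g (x', y)) - (LINT y:B|lborel. g (x, y)) -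
      (\<Sum>b\<in>Basis. ((x' - x) \<bullet> b) *\<^sub>R (LINT y:B|lborel. ?P b (x, y)))) \<le> e * norm (x' - x)"
      by (simp add: mult.assoc mult.commute mult.left_commute)
  qed
qed

text \<open>Differentiating in \<open>x\<close> turns the integral of \<open>g\<close> into the
  integral of its derivative along \<open>(b, 0)\<close>, so parameter integrals form a class closed
  under differentiation.\<close>

lemma nets_of_rate_set_integral:
  assumes R: "rate_ideal R" and X: "open X" and g: "g \<in> nets_of_rate R Z"
    and C: "compact C" "X \<times> C \<subseteq> Z" and B: "B \<in> sets borel" "B \<subseteq> C"
  shows "(\<lambda>\<epsilon> x. LINT y:B|lborel. g \<epsilon> (x, y)) \<in> nets_of_rate R X"
proof (rule nets_of_rate_coinduct[OF R X])
  let ?I = "\<lambda>g \<epsilon> x. LINT y:B|lborel. g \<epsilon> (x, y)"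
  let ?S = "?I ` nets_of_rate R Z"
  show "?I g \<in> ?S" using g by (rule imageI)
  fix v assume "v \<in> ?S"
  then obtain g where v: "v = ?I g" and g: "g \<in> nets_of_rate R Z" by (rule imageE)
  have D: "(v \<epsilon> has_derivative
      (\<lambda>h. \<Sum>b\<in>Basis. (h \<bullet> b) *\<^sub>R (LINT y:B|lborel. partial_deriv (b, 0) (g \<epsilon>) (x, y)))) (at x)"
    if "0 < \<epsilon>" "\<epsilon> \<le> 1" "x \<in> X" for \<epsilon> x
    unfolding v by (rule has_derivative_set_integral[OF nets_of_rate_smooth[OF g that(1,2)] X that(3) C B])
  then show "v \<epsilon> differentiable (at x)" if "0 < \<epsilon>" "\<epsilon> \<le> 1" "x \<in> X" for \<epsilon> x
    using that unfolding differentiable_def by blast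
  show "bounded_at_rate R K v" if K: "compact K" "K \<subseteq> X" for K
  proof -
    have "K \<times> C \<subseteq> Z" using K C by blast
    then obtain s where s: "s \<in> R" "\<forall>\<^sub>F \<epsilon> in at_right 0. \<forall>z\<in>K \<times> C. cmod (g \<epsilon> z) \<le> s \<epsilon>"
      using nets_of_rate_bounded[OF R g compact_Times[OF K(1) C(1)]] unfolding bounded_at_rate_def by blast
    have "\<forall>\<^sub>F \<epsilon> in at_right 0. \<forall>x\<in>K. cmod (v \<epsilon> x) \<le> measure lborel C * \<bar>s \<epsilon>\<bar>"
      using s(2) eventually_unit
    proof eventually_elim
      case (elim \<epsilon>)
      show ?case
      proof
        fix x assume x: "x \<in> K"
        have "continuous_on C (\<lambda>y. g \<epsilon> (x, y))"
          by (rule continuous_on_compose2[OF smooth_on_continuous0[OF nets_of_rate_smooth[OF g]]])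
             (use elim x K C in \<open>auto intro!: continuous_intros\<close>)
        then have "cmod (v \<epsilon> x) \<le> \<bar>s \<epsilon>\<bar> * measure lborel C"
          unfolding v using elim(1) x by (intro norm_set_integral_le C B) force+
        then show "cmod (v \<epsilon> x) \<le> measure lborel C * \<bar>s \<epsilon>\<bar>" by (simp add: mult.commute)
      qed
    qed
    moreover have "(\<lambda>\<epsilon>. measure lborel C * \<bar>s \<epsilon>\<bar>) \<in> R"
      by (intro rate_ideal_mult[OF R] moderate_rates_const rate_ideal_abs[OF R s(1)])
    ultimately show ?thesis by (rule bounded_at_rateI[rotated])
  qed
  show "\<exists>w\<in>?S. \<forall>\<epsilon> x. 0 < \<epsilon> \<longrightarrow> \<epsilon> \<le> 1 \<longrightarrow> x \<in> X \<longrightarrow> partial_deriv b (v \<epsilon>) x = w \<epsilon> x" if b: "b \<in> Basis" for b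
  proof (intro bexI allI impI)
    have "(b, 0) \<in> Basis" using b by (simp add: Basis_prod_def)
    from nets_of_rate_partial_deriv[OF R g this]
    show "?I (\<lambda>\<epsilon>. partial_deriv (b, 0) (g \<epsilon>)) \<in> ?S" by (rule imageI)
    fix \<epsilon> :: real and x assume e: "0 < \<epsilon>" "\<epsilon> \<le> 1" "x \<in> X"
    show "partial_deriv b (v \<epsilon>) x = ?I (\<lambda>\<epsilon>. partial_deriv (b, 0) (g \<epsilon>)) \<epsilon> x"
      unfolding partial_deriv_eq[OF D[OF e]]
      using b by (simp add: inner_Basis if_distrib[of "\<lambda>c. c *\<^sub>R _"] cong: if_cong)
  qed
qed

section \<open>Negligibility is an order zero condition\<close>

lemma has_vector_derivative_line:
  assumes "f differentiable (at (z + t *\<^sub>R b))"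
  shows "((\<lambda>t. f (z + t *\<^sub>R b)) has_vector_derivative partial_deriv b f (z + t *\<^sub>R b)) (at t)"
proof -
  obtain D where D: "(f has_derivative D) (at (z + t *\<^sub>R b))"
    using assms unfolding differentiable_def by blast
  have "((\<lambda>t. f (z + t *\<^sub>R b)) has_derivative (\<lambda>h. D (h *\<^sub>R b))) (at t)"
    by (rule has_derivative_compose[where f = "\<lambda>t. z + t *\<^sub>R b" and g = f, OF _ D])
       (auto intro!: derivative_eq_intros)
  moreover have "D (h *\<^sub>R b) = h *\<^sub>R D b" for h
    using D has_derivative_bounded_linear linear_simps(5) by blast
  ultimately show ?thesis
    by (simp add: has_vector_derivative_def partial_deriv_eq[OF D])
qed

text \<open>An interpolation inequality of Landau type: \<open>t\<close> times the derivative is a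
  difference of two values of \<open>f\<close> up to a remainder of at most
  \<open>M * t * t\<close>, and the step \<open>t\<close> remains free to balance the two
  terms.\<close>

lemma cmod_partial_deriv_le:
  assumes f: "smooth_on \<Omega> f" and S: "convex S" "S \<subseteq> \<Omega>" "z \<in> S" "z + t *\<^sub>R b \<in> S" and t: "t > 0"
    and b: "b \<in> Basis"
    and s: "\<And>x. x \<in> S \<Longrightarrow> cmod (f x) \<le> s"
    and M: "\<And>x. x \<in> S \<Longrightarrow> cmod (partial_deriv b (partial_deriv b f) x) \<le> M"
  shows "cmod (partial_deriv b f z) \<le> 2 * s / t + t * M"
proof -
  let ?p = "\<lambda>\<tau>. z + \<tau> *\<^sub>R b"
  have M0: "0 \<le> M" using M[OF S(3)] norm_ge_zero order_trans by blast
  have inS: "?p \<tau> \<in> S" if "\<tau> \<in> {0..t}" for \<tau>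
  proof -
    have "(1 - \<tau> / t) *\<^sub>R z + (\<tau> / t) *\<^sub>R (z + t *\<^sub>R b) \<in> S"
      using that t S by (intro convexD_alt) auto
    also have "(1 - \<tau> / t) *\<^sub>R z + (\<tau> / t) *\<^sub>R (z + t *\<^sub>R b) = ?p \<tau>"
      using t by (simp add: algebra_simps)
    finally show ?thesis .
  qed
  have d1: "((\<lambda>\<tau>. f (?p \<tau>)) has_vector_derivative partial_deriv b f (?p \<tau>)) (at \<tau> within {0..t})"
    if "\<tau> \<in> {0..t}" for \<tau>
    using inS[OF that] S(2) f
    by (intro has_vector_derivative_at_within[OF has_vector_derivative_line] smooth_on_differentiable[of \<Omega>]) auto
  have d2: "((\<lambda>\<tau>. partial_deriv b f (?p \<tau>)) has_vector_derivative
      partial_deriv b (partial_deriv b f) (?p \<tau>)) (at \<tau> within {0..t})"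
    if "\<tau> \<in> {0..t}" for \<tau>
    using inS[OF that] S(2) smooth_on_partial_deriv[OF f b]
    by (intro has_vector_derivative_at_within[OF has_vector_derivative_line] smooth_on_differentiable[of \<Omega>]) auto
  have "cmod (f (?p t) - f (?p 0) - (t - 0) *\<^sub>R partial_deriv b f (?p 0)) \<le> norm (t - 0) * (M * t)"
  proof (rule vector_differentiable_bound_linearization[of "{0..t}"])
    fix \<tau> assume \<tau>: "\<tau> \<in> {0..t}"
    have "cmod (partial_deriv b f (?p \<tau>) - partial_deriv b f (?p 0)) \<le> M * norm (\<tau> - 0)"
    proof (rule differentiable_bound[of "{0..t}" "\<lambda>\<tau>. partial_deriv b f (?p \<tau>)"
          "\<lambda>\<tau> h. h *\<^sub>R partial_deriv b (partial_deriv b f) (?p \<tau>)"])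
      fix \<sigma> assume "\<sigma> \<in> {0..t}"
      then show "onorm (\<lambda>h. h *\<^sub>R partial_deriv b (partial_deriv b f) (?p \<sigma>)) \<le> M"
        using M[OF inS] by (intro onorm_le) (auto simp: mult.commute[of M] intro!: mult_left_mono)
    qed (use d2 \<tau> t in \<open>auto simp: has_vector_derivative_def\<close>)
    also have "\<dots> \<le> M * t" using \<tau> M0 by (auto intro!: mult_left_mono)
    finally show "cmod (partial_deriv b f (?p \<tau>) - partial_deriv b f (?p 0)) \<le> M * t" .
  qed (use d1 t in \<open>auto simp: closed_segment_eq_real_ivl\<close>)
  then have "cmod (f (?p t) - f z - t *\<^sub>R partial_deriv b f z) \<le> t * (M * t)" using t by simp
  moreover have "cmod (f (?p t)) \<le> s" "cmod (f z) \<le> s" using s S by auto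
  moreover have "cmod w \<le> cmod p + cmod q + cmod (p - q - w)" for p q w
    by norm
  note this[of "t *\<^sub>R partial_deriv b f z" "f (?p t)" "f z"]
  ultimately have "t * cmod (partial_deriv b f z) \<le> 2 * s + t * (M * t)" using t by simp
  then show ?thesis using t by (simp add: field_simps)
qed

text \<open>The premise has a bound for each order, the conclusion wants one majorant for all
  orders. The supremum over \<open>K\<close> is such a majorant.\<close>

lemma bounded_at_negligible_rateI:
  assumes "\<And>n::nat. \<exists>C. \<forall>\<^sub>F \<epsilon> in at_right 0. \<forall>x\<in>K. cmod (u \<epsilon> x) \<le> C * \<epsilon> ^ n"
  shows "bounded_at_rate negligible_rates K u"
proof (cases "K = {}")
  case True
  then show ?thesis using rate_ideal_zero[OF rate_ideal_negligible] by (auto simp: bounded_at_rate_def)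
next
  case False
  then obtain x0 where x0: "x0 \<in> K" by blast
  define s where "s \<epsilon> = (SUP x\<in>K. cmod (u \<epsilon> x))" for \<epsilon>
  have *: "\<forall>x\<in>K. cmod (u \<epsilon> x) \<le> s \<epsilon>" if "\<forall>x\<in>K. cmod (u \<epsilon> x) \<le> B" for \<epsilon> B
    unfolding s_def using that by (auto intro!: cSUP_upper bdd_aboveI2)
  show ?thesis
  proof (rule bounded_at_rateI)
    \<comment> \<open>Order 0 already gives boundedness for small \<open>\<epsilon>\<close>, without
      which the supremum would say nothing.\<close>
    obtain C where "\<forall>\<^sub>F \<epsilon> in at_right 0. \<forall>x\<in>K. cmod (u \<epsilon> x) \<le> C * \<epsilon> ^ 0" using assms by blast
    then show "\<forall>\<^sub>F \<epsilon> in at_right 0. \<forall>x\<in>K. cmod (u \<epsilon> x) \<le> s \<epsilon>"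
      by eventually_elim (rule *)
    show "s \<in> negligible_rates"
    proof (rule negligible_ratesI)
      fix n
      obtain C where "\<forall>\<^sub>F \<epsilon> in at_right 0. \<forall>x\<in>K. cmod (u \<epsilon> x) \<le> C * \<epsilon> ^ n" using assms by blast
      then have "\<forall>\<^sub>F \<epsilon> in at_right 0. \<bar>s \<epsilon>\<bar> \<le> C * \<epsilon> ^ n"
      proof eventually_elim
        case (elim \<epsilon>)
        have "0 \<le> s \<epsilon>" using *[OF elim] x0 norm_ge_zero order_trans by blast
        moreover have "s \<epsilon> \<le> C * \<epsilon> ^ n"
          unfolding s_def using elim False by (auto intro: cSUP_least)
        ultimately show ?case by simp
      qed
      then show "\<exists>C. \<forall>\<^sub>F \<epsilon> in at_right 0. \<bar>s \<epsilon>\<bar> \<le> C * \<epsilon> ^ n" by blast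
    qed
  qed
qed

lemma bounded_at_negligible_rateD:
  fixes n :: nat
  assumes "bounded_at_rate negligible_rates K u"
  obtains C where "C > 0" "\<forall>\<^sub>F \<epsilon> in at_right 0. \<forall>x\<in>K. cmod (u \<epsilon> x) \<le> C * \<epsilon> ^ n"
proof -
  obtain s where s: "s \<in> negligible_rates" "\<forall>\<^sub>F \<epsilon> in at_right 0. \<forall>x\<in>K. cmod (u \<epsilon> x) \<le> s \<epsilon>"
    using assms unfolding bounded_at_rate_def by blast
  obtain C where C: "C > 0" "\<forall>\<^sub>F \<epsilon> in at_right 0. \<bar>s \<epsilon>\<bar> \<le> C * \<epsilon> ^ n"
    by (rule negligible_ratesD[OF s(1)])
  have "\<forall>\<^sub>F \<epsilon> in at_right 0. \<forall>x\<in>K. cmod (u \<epsilon> x) \<le> C * \<epsilon> ^ n"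
    using s(2) C(2) by eventually_elim fastforce
  with C(1) show thesis by (rule that)
qed

lemma bounded_at_moderate_rateD:
  assumes "bounded_at_rate moderate_rates K u"
  obtains C n where "C > 0" "\<forall>\<^sub>F \<epsilon> in at_right 0. \<forall>x\<in>K. cmod (u \<epsilon> x) \<le> C / \<epsilon> ^ n"
proof -
  obtain s where s: "s \<in> moderate_rates" "\<forall>\<^sub>F \<epsilon> in at_right 0. \<forall>x\<in>K. cmod (u \<epsilon> x) \<le> s \<epsilon>"
    using assms unfolding bounded_at_rate_def by blast
  obtain C n where C: "C > 0" "\<forall>\<^sub>F \<epsilon> in at_right 0. \<bar>s \<epsilon>\<bar> \<le> C / \<epsilon> ^ n"
    by (rule moderate_ratesD[OF s(1)])
  have "\<forall>\<^sub>F \<epsilon> in at_right 0. \<forall>x\<in>K. cmod (u \<epsilon> x) \<le> C / \<epsilon> ^ n"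
    using s(2) C(2) by eventually_elim fastforce
  with C(1) show thesis by (rule that)
qed

lemma bounded_at_rate_partial_deriv:
  assumes \<Omega>: "open \<Omega>" and u: "u \<in> nets_of_rate moderate_rates \<Omega>"
    and 0: "\<And>K. compact K \<Longrightarrow> K \<subseteq> \<Omega> \<Longrightarrow> bounded_at_rate negligible_rates K u"
    and b: "b \<in> Basis" and K: "compact K" "K \<subseteq> \<Omega>"
  shows "bounded_at_rate negligible_rates K (\<lambda>\<epsilon>. partial_deriv b (u \<epsilon>))"
proof (rule bounded_at_rate_local[OF rate_ideal_negligible K(1)])
  fix x assume "x \<in> K"
  then obtain r' where r': "r' > 0" "cball x r' \<subseteq> \<Omega>" using K \<Omega> open_contains_cball by blast
  \<comment> \<open>Halving leaves room for a step of length at most \<open>r\<close> from any point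
    of \<open>ball x r\<close>.\<close>
  define r where "r = r' / 2"
  have r: "r > 0" "cball x (2 * r) \<subseteq> \<Omega>" using r' by (auto simp: r_def)
  have "(\<lambda>\<epsilon>. partial_deriv b (partial_deriv b (u \<epsilon>))) \<in> nets_of_rate moderate_rates \<Omega>"
    using nets_of_rate_partial_deriv[OF rate_ideal_moderate
        nets_of_rate_partial_deriv[OF rate_ideal_moderate u b] b] by simp
  from nets_of_rate_bounded[OF rate_ideal_moderate this compact_cball r(2)]
  obtain M m where M: "M > 0" "\<forall>\<^sub>F \<epsilon> in at_right 0. \<forall>z\<in>cball x (2 * r).
      cmod (partial_deriv b (partial_deriv b (u \<epsilon>)) z) \<le> M / \<epsilon> ^ m"
    by (rule bounded_at_moderate_rateD)
  have "bounded_at_rate negligible_rates (ball x r) (\<lambda>\<epsilon>. partial_deriv b (u \<epsilon>))"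
  proof (rule bounded_at_negligible_rateI)
    fix n
    \<comment> \<open>With the step \<open>t = r * \<epsilon> ^ (m + n)\<close> the second order
      term, of size \<open>t * M / \<epsilon> ^ m\<close>, is of order \<open>n\<close>; order
      \<open>m + 2 * n\<close> for \<open>u\<close> makes the quotient by \<open>t\<close> of order
      \<open>n\<close> too.\<close>
    obtain C where C: "C > 0" "\<forall>\<^sub>F \<epsilon> in at_right 0. \<forall>z\<in>cball x (2 * r). cmod (u \<epsilon> z) \<le> C * \<epsilon> ^ (m + 2 * n)"
      by (rule bounded_at_negligible_rateD[OF 0[OF compact_cball r(2)]])
    have "\<forall>\<^sub>F \<epsilon> in at_right 0. \<forall>z\<in>ball x r. cmod (partial_deriv b (u \<epsilon>) z) \<le> (2 * C / r + r * M) * \<epsilon> ^ n"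
      using M(2) C(2) eventually_unit
    proof eventually_elim
      case (elim \<epsilon>)
      show ?case
      proof
        fix z assume z: "z \<in> ball x r"
        define t where "t = r * \<epsilon> ^ (m + n)"
        have t: "t > 0" "t \<le> r" using elim r by (auto simp: t_def power_le_one mult_left_le)
        have "dist x (z + t *\<^sub>R b) \<le> dist x z + norm (t *\<^sub>R b)"
          using dist_triangle[of x "z + t *\<^sub>R b" z] by (simp add: dist_norm)
        then have zt: "z + t *\<^sub>R b \<in> cball x (2 * r)" using z t b by simp
        have "cmod (partial_deriv b (u \<epsilon>) z) \<le> 2 * (C * \<epsilon> ^ (m + 2 * n)) / t + t * (M / \<epsilon> ^ m)"
        proof (rule cmod_partial_deriv_le[where S = "cball x (2 * r)" and \<Omega> = \<Omega>])
          show "smooth_on \<Omega> (u \<epsilon>)" using u elim by (auto intro: nets_of_rate_smooth)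
        qed (use r z zt t b elim in auto)
        also have "2 * (C * \<epsilon> ^ (m + 2 * n)) / t = 2 * C / r * \<epsilon> ^ n"
        proof -
          have "\<epsilon> ^ (m + 2 * n) = \<epsilon> ^ (m + n) * \<epsilon> ^ n" by (simp flip: power_add add: mult_2 add.assoc)
          then show ?thesis using elim(3) by (simp add: t_def)
        qed
        also have "t * (M / \<epsilon> ^ m) = r * M * \<epsilon> ^ n"
          using elim(3) by (simp add: t_def power_add)
        also have "2 * C / r * \<epsilon> ^ n + r * M * \<epsilon> ^ n = (2 * C / r + r * M) * \<epsilon> ^ n"
          by (simp only: distrib_right)
        finally show "cmod (partial_deriv b (u \<epsilon>) z) \<le> (2 * C / r + r * M) * \<epsilon> ^ n" .
      qed
    qed
    then show "\<exists>C. \<forall>\<^sub>F \<epsilon> in at_right 0. \<forall>z\<in>ball x r. cmod (partial_deriv b (u \<epsilon>) z) \<le> C * \<epsilon> ^ n" ..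
  qed
  then show "\<exists>T. open T \<and> x \<in> T \<and> bounded_at_rate negligible_rates T (\<lambda>\<epsilon>. partial_deriv b (u \<epsilon>))"
    using r by (intro exI[of _ "ball x r"]) simp
qed

text \<open>Moderate nets with negligible values form a class closed under differentiation, by the
  interpolation estimate; it is therefore an admissible invariant class.\<close>

lemma negligible_if_order_zero:
  assumes \<Omega>: "open \<Omega>" and u: "u \<in> nets_of_rate moderate_rates \<Omega>"
    and 0: "\<And>K. compact K \<Longrightarrow> K \<subseteq> \<Omega> \<Longrightarrow> bounded_at_rate negligible_rates K u"
  shows "u \<in> nets_of_rate negligible_rates \<Omega>"
proof (rule nets_of_rate_coinduct[OF rate_ideal_negligible \<Omega>])
  let ?S = "{u \<in> nets_of_rate moderate_rates \<Omega>.
    \<forall>K. compact K \<longrightarrow> K \<subseteq> \<Omega> \<longrightarrow> bounded_at_rate negligible_rates K u}"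
  show "u \<in> ?S" using u 0 by simp
  fix v assume v: "v \<in> ?S"
  show "v \<epsilon> differentiable (at x)" if "0 < \<epsilon>" "\<epsilon> \<le> 1" "x \<in> \<Omega>" for \<epsilon> x
    using v that by (intro smooth_on_differentiable[OF nets_of_rate_smooth]) auto
  show "bounded_at_rate negligible_rates K v" if "compact K" "K \<subseteq> \<Omega>" for K
    using v that by simp
  show "\<exists>w\<in>?S. \<forall>\<epsilon> x. 0 < \<epsilon> \<longrightarrow> \<epsilon> \<le> 1 \<longrightarrow> x \<in> \<Omega> \<longrightarrow> partial_deriv b (v \<epsilon>) x = w \<epsilon> x" if b: "b \<in> Basis" for b
    using v b by (intro bexI[of _ "\<lambda>\<epsilon>. partial_deriv b (v \<epsilon>)"])
      (auto intro: nets_of_rate_partial_deriv rate_ideal_moderate bounded_at_rate_partial_deriv[OF \<Omega>])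
qed

section \<open>A smooth bump function\<close>

text \<open>The span of these functions is closed under differentiation and contains \<open>exp (- 1 / t)\<close> cut off at 0.\<close>

definition flat_exp :: "nat \<Rightarrow> real \<Rightarrow> real" where
  "flat_exp k t = (if t > 0 then exp (- (1 / t)) / t ^ k else 0)"

lemma flat_exp_tendsto_0: "(flat_exp k \<longlongrightarrow> 0) (at 0)"
proof (rule filterlim_split_at)
  have "((\<lambda>t. 0) \<longlongrightarrow> 0) (at_left (0::real))" by simp
  moreover have "\<forall>\<^sub>F t in at_left 0. 0 = flat_exp k t"
    unfolding eventually_at_filter by (simp add: flat_exp_def)
  ultimately show "(flat_exp k \<longlongrightarrow> 0) (at_left 0)" by (rule Lim_transform_eventually)
  have "((\<lambda>t. inverse t ^ k / exp (inverse t)) \<longlongrightarrow> 0) (at_right (0::real))"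
    by (rule filterlim_compose[OF tendsto_power_div_exp_0 filterlim_inverse_at_top_right])
  moreover have "\<forall>\<^sub>F t in at_right 0. inverse t ^ k / exp (inverse t) = flat_exp k t"
    using eventually_unit
    by eventually_elim (simp add: flat_exp_def exp_minus field_simps)
  ultimately show "(flat_exp k \<longlongrightarrow> 0) (at_right 0)" by (rule Lim_transform_eventually)
qed

text \<open>For \<open>t > 0\<close> this is the product rule for \<open>exp (- (1 / t))\<close> and
  \<open>t\<close> to the power \<open>- k\<close>; at 0 the decay of the exponential beats every
  power.\<close>

lemma flat_exp_has_real_derivative:
  "(flat_exp k has_real_derivative (flat_exp (k + 2) t - of_nat k * flat_exp (k + 1) t)) (at t)"
proof -
  consider "t > 0" | "t < 0" | "t = 0" by linarith
  then show ?thesis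
  proof cases
    case 1
    have "((\<lambda>t. exp (- (1 / t)) / t ^ k) has_real_derivative
        (flat_exp (k + 2) t - of_nat k * flat_exp (k + 1) t)) (at t)"
    proof (cases k)
      case 0
      then show ?thesis using 1 by (auto intro!: derivative_eq_intros simp: flat_exp_def field_simps power2_eq_square)
    next
      case (Suc j)
      then show ?thesis
        using 1 by (auto intro!: derivative_eq_intros simp: flat_exp_def divide_simps)
          (auto simp: algebra_simps, cases j, auto)
    qed
    then show ?thesis
      by (rule has_field_derivative_transform_within_open[where S = "{0<..}"]) (use 1 in \<open>auto simp: flat_exp_def\<close>)
  next
    case 2
    have "((\<lambda>t. 0) has_real_derivative (flat_exp (k + 2) t - of_nat k * flat_exp (k + 1) t)) (at t)"
      using 2 by (simp add: flat_exp_def)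
    then show ?thesis
      by (rule has_field_derivative_transform_within_open[where S = "{..<0}"]) (use 2 in \<open>auto simp: flat_exp_def\<close>)
  next
    case 3
    \<comment> \<open>The difference quotient at 0 is the next function of the family, so its limit
      is already known. At \<open>h = 0\<close> the equation holds since division by 0 yields
      0.\<close>
    have quotient: "flat_exp (k + 1) = (\<lambda>h. (flat_exp k (0 + h) - flat_exp k 0) / h)"
      by (auto simp: flat_exp_def)
    have "((\<lambda>h. (flat_exp k (0 + h) - flat_exp k 0) / h) \<longlongrightarrow> 0) (at 0)"
      using flat_exp_tendsto_0[of "k + 1"] unfolding quotient .
    moreover have "flat_exp j 0 = 0" for j by (simp add: flat_exp_def)
    ultimately show ?thesis unfolding 3 DERIV_def by simp
  qed
qed

lemma continuous_on_flat_exp: "continuous_on S (flat_exp k)"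
  using flat_exp_has_real_derivative DERIV_isCont continuous_at_imp_continuous_on by blast

text \<open>Affine functions appear as the partial derivatives of the squared distance inside the
  bump. Constants are the case \<open>w = 0\<close>, so the class is closed.\<close>

lemma nets_of_rate_affine:
  "(\<lambda>\<epsilon> y. complex_of_real (c + y \<bullet> w)) \<in> nets_of_rate moderate_rates UNIV"
proof (rule nets_of_rate_coinduct[OF rate_ideal_moderate open_UNIV])
  let ?S = "{\<lambda>(\<epsilon>::real) (y::'a). complex_of_real (c + y \<bullet> w) | c w. True}"
  show "(\<lambda>\<epsilon> y. complex_of_real (c + y \<bullet> w)) \<in> ?S" by blast
  fix v assume "v \<in> ?S"
  then obtain c w where v: "v = (\<lambda>\<epsilon> y. complex_of_real (c + y \<bullet> w))" by blast
  have D: "(v \<epsilon> has_derivative (\<lambda>h. complex_of_real (h \<bullet> w))) (at x)" for \<epsilon> x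
    unfolding v by (auto intro!: derivative_eq_intros)
  then show "v \<epsilon> differentiable (at x)" for \<epsilon> x unfolding differentiable_def by blast
  show "bounded_at_rate moderate_rates K v" if "compact K" for K
  proof -
    have "compact ((\<lambda>y. complex_of_real (c + y \<bullet> w)) ` K)"
      by (intro compact_continuous_image continuous_intros that)
    then obtain B where "\<forall>y\<in>K. cmod (complex_of_real (c + y \<bullet> w)) \<le> B"
      by (auto dest!: compact_imp_bounded simp: bounded_iff)
    then show ?thesis
      unfolding v by (intro bounded_at_rateI[OF moderate_rates_const[of B]]) simp
  qed
  show "\<exists>w\<in>?S. \<forall>\<epsilon> x. 0 < \<epsilon> \<longrightarrow> \<epsilon> \<le> 1 \<longrightarrow> x \<in> UNIV \<longrightarrow> partial_deriv b (v \<epsilon>) x = w \<epsilon> x" for b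
  proof (intro bexI allI impI)
    show "(\<lambda>\<epsilon> y. complex_of_real (b \<bullet> w + y \<bullet> 0)) \<in> ?S" by blast
  qed (simp add: partial_deriv_eq[OF D])
qed

text \<open>The invariant class of the bump: a derivative either hits the coefficient
  \<open>v\<close> or raises \<open>k\<close> by 1 or 2 and multiplies the coefficient by an affine
  function. Arbitrary moderate coefficients absorb these factors.\<close>

inductive_set radial_flat_nets :: "'a::euclidean_space \<Rightarrow> real \<Rightarrow> 'a net set" for y0 a where
  mult: "v \<in> nets_of_rate moderate_rates UNIV \<Longrightarrow>
    (\<lambda>\<epsilon> y. v \<epsilon> y * complex_of_real (flat_exp k (a\<^sup>2 - (norm (y - y0))\<^sup>2))) \<in> radial_flat_nets y0 a"
| sum: "u \<in> radial_flat_nets y0 a \<Longrightarrow> v \<in> radial_flat_nets y0 a \<Longrightarrow>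
    (\<lambda>\<epsilon> y. u \<epsilon> y + v \<epsilon> y) \<in> radial_flat_nets y0 a"

lemma has_derivative_flat_exp_radial:
  "((\<lambda>y. complex_of_real (flat_exp k (a\<^sup>2 - (norm (y - y0))\<^sup>2))) has_derivative
    (\<lambda>h. complex_of_real ((flat_exp (k + 2) (a\<^sup>2 - (norm (y - y0))\<^sup>2) -
      of_nat k * flat_exp (k + 1) (a\<^sup>2 - (norm (y - y0))\<^sup>2)) * (- 2 * ((y - y0) \<bullet> h))))) (at y)"
proof -
  \<comment> \<open>The inner product form is differentiable everywhere, while the norm itself is
    not at the centre.\<close>
  have "((\<lambda>y. a\<^sup>2 - (y - y0) \<bullet> (y - y0)) has_derivative (\<lambda>h. - 2 * ((y - y0) \<bullet> h))) (at y)"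
    by (auto intro!: derivative_eq_intros simp: inner_commute)
  then have "((\<lambda>y. flat_exp k (a\<^sup>2 - (y - y0) \<bullet> (y - y0))) has_derivative
     (\<lambda>h. (flat_exp (k + 2) (a\<^sup>2 - (y - y0) \<bullet> (y - y0)) -
      of_nat k * flat_exp (k + 1) (a\<^sup>2 - (y - y0) \<bullet> (y - y0))) * (- 2 * ((y - y0) \<bullet> h)))) (at y)"
    by (rule has_derivative_compose[OF _ flat_exp_has_real_derivative[unfolded has_field_derivative_def]])
  then show ?thesis
    unfolding power2_norm_eq_inner by (rule has_derivative_of_real)
qed

lemma radial_flat_nets_subset: "radial_flat_nets y0 a \<subseteq> nets_of_rate moderate_rates UNIV"
proof
  let ?f = "\<lambda>k y. complex_of_real (flat_exp k (a\<^sup>2 - (norm (y - y0))\<^sup>2))"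
  fix u assume "u \<in> radial_flat_nets y0 a"
  then show "u \<in> nets_of_rate moderate_rates UNIV"
  proof (rule nets_of_rate_coinduct[OF rate_ideal_moderate open_UNIV])
    have diff: "z \<epsilon> differentiable (at x)" if "z \<in> radial_flat_nets y0 a" "0 < \<epsilon>" "\<epsilon> \<le> 1" for z \<epsilon> x
      using that
    proof (induction)
      case (mult v k)
      have "?f k differentiable (at x)"
        using has_derivative_flat_exp_radial unfolding differentiable_def by blast
      with mult show ?case
        by (auto intro!: differentiable_mult intro: smooth_on_differentiable[OF nets_of_rate_smooth])
    qed auto
    then show "\<And>z \<epsilon> x. \<lbrakk>z \<in> radial_flat_nets y0 a; 0 < \<epsilon>; \<epsilon> \<le> 1; x \<in> UNIV\<rbrakk> \<Longrightarrow> z \<epsilon> differentiable (at x)" .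
    show "bounded_at_rate moderate_rates K z" if "z \<in> radial_flat_nets y0 a" "compact K" for z K
      using that
    proof (induction)
      case (mult v k)
      have "continuous_on K (?f k)"
        by (intro continuous_intros continuous_on_compose2[OF continuous_on_flat_exp[of UNIV]]) auto
      then have "compact (?f k ` K)" using mult by (intro compact_continuous_image)
      then obtain B where "\<forall>y\<in>K. cmod (?f k y) \<le> B"
        by (auto dest!: compact_imp_bounded simp: bounded_iff)
      then have "bounded_at_rate moderate_rates K (\<lambda>\<epsilon>. ?f k)"
        by (intro bounded_at_rateI[OF moderate_rates_const[of B]]) simp
      then show ?case
        using mult by (intro bounded_at_rate_mult rate_ideal_moderate)
          (auto intro: nets_of_rate_bounded rate_ideal_moderate)
    qed (auto intro!: bounded_at_rate_add rate_ideal_moderate)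
    show "\<exists>w\<in>radial_flat_nets y0 a. \<forall>\<epsilon> x. 0 < \<epsilon> \<longrightarrow> \<epsilon> \<le> 1 \<longrightarrow> x \<in> UNIV \<longrightarrow> partial_deriv b (z \<epsilon>) x = w \<epsilon> x"
      if "z \<in> radial_flat_nets y0 a" "b \<in> Basis" for z b
      using that
    proof (induction)
      case (mult v k)
      \<comment> \<open>This is \<open>- 2 * ((y - y0) \<bullet> b)\<close>, the inner derivative,
        written in affine form.\<close>
      let ?l = "\<lambda>y. complex_of_real (2 * (y0 \<bullet> b) + y \<bullet> ((- 2) *\<^sub>R b))"
      let ?w = "\<lambda>\<epsilon> y. partial_deriv b (v \<epsilon>) y * ?f k y + ((v \<epsilon> y * ?l y) * ?f (k + 2) y +
        (- of_nat k * (v \<epsilon> y * ?l y)) * ?f (k + 1) y)"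
      have vl: "(\<lambda>\<epsilon> y. v \<epsilon> y * ?l y) \<in> nets_of_rate moderate_rates UNIV"
        by (intro nets_of_rate_mult rate_ideal_moderate open_UNIV mult nets_of_rate_affine)
      have "?w \<in> radial_flat_nets y0 a"
        by (intro radial_flat_nets.intros nets_of_rate_partial_deriv rate_ideal_moderate mult vl
            nets_of_rate_mult open_UNIV nets_of_rate_const)
      moreover have "partial_deriv b (\<lambda>y. v \<epsilon> y * ?f k y) y = ?w \<epsilon> y" if e: "0 < \<epsilon>" "\<epsilon> \<le> 1" for \<epsilon> y
      proof -
        obtain D where D: "(v \<epsilon> has_derivative D) (at y)"
          by (rule nets_of_rate_has_derivative[OF mult(1) e UNIV_I])
        show ?thesis
          unfolding partial_deriv_eq[OF has_derivative_mult[OF D has_derivative_flat_exp_radial]] partial_deriv_eq[OF D]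
          by (simp add: algebra_simps)
      qed
      ultimately show ?case by (intro bexI[of _ ?w]) auto
    next
      case (sum u v)
      then obtain u' v' where u': "u' \<in> radial_flat_nets y0 a"
          "\<And>\<epsilon> x. 0 < \<epsilon> \<Longrightarrow> \<epsilon> \<le> 1 \<Longrightarrow> partial_deriv b (u \<epsilon>) x = u' \<epsilon> x"
        and v': "v' \<in> radial_flat_nets y0 a"
          "\<And>\<epsilon> x. 0 < \<epsilon> \<Longrightarrow> \<epsilon> \<le> 1 \<Longrightarrow> partial_deriv b (v \<epsilon>) x = v' \<epsilon> x"
        by blast
      have "partial_deriv b (\<lambda>x. u \<epsilon> x + v \<epsilon> x) x = u' \<epsilon> x + v' \<epsilon> x" if e: "0 < \<epsilon>" "\<epsilon> \<le> 1" for \<epsilon> x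
      proof -
        obtain D E where D: "(u \<epsilon> has_derivative D) (at x)" and E: "(v \<epsilon> has_derivative E) (at x)"
          using diff[OF sum(1) e, of x] diff[OF sum(2) e, of x] unfolding differentiable_def by blast
        show ?thesis
          using partial_deriv_eq[OF has_derivative_add[OF D E], of b]
            partial_deriv_eq[OF D, of b] partial_deriv_eq[OF E, of b] u'(2)[OF e] v'(2)[OF e] by simp
      qed
      moreover have "(\<lambda>\<epsilon> x. u' \<epsilon> x + v' \<epsilon> x) \<in> radial_flat_nets y0 a"
        using u'(1) v'(1) by (rule radial_flat_nets.sum)
      ultimately show ?case by (intro bexI[of _ "\<lambda>\<epsilon> x. u' \<epsilon> x + v' \<epsilon> x"]) auto
    qed
  qed
qed

text \<open>The function is \<open>exp (- 1 / (a^2 - |y - y0|^2))\<close> inside the ball.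
  Positivity on the whole open ball yields a positive minimum on every smaller closed ball.\<close>

lemma smooth_bump:
  fixes y0 :: "'a::euclidean_space"
  assumes "0 < a"
  obtains \<psi> :: "'a \<Rightarrow> real" where "(\<lambda>\<epsilon> y. complex_of_real (\<psi> y)) \<in> nets_of_rate moderate_rates UNIV"
    "continuous_on UNIV \<psi>" "\<And>y. 0 \<le> \<psi> y" "\<And>y. y \<in> ball y0 a \<Longrightarrow> 0 < \<psi> y" "\<And>y. y \<notin> ball y0 a \<Longrightarrow> \<psi> y = 0"
proof (rule that)
  let ?\<psi> = "\<lambda>y. flat_exp 0 (a\<^sup>2 - (norm (y - y0))\<^sup>2)"
  have "(\<lambda>\<epsilon> y. 1 * complex_of_real (?\<psi> y)) \<in> radial_flat_nets y0 a"
    by (intro radial_flat_nets.mult nets_of_rate_const open_UNIV)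
  then show "(\<lambda>\<epsilon> y. complex_of_real (?\<psi> y)) \<in> nets_of_rate moderate_rates UNIV"
    using radial_flat_nets_subset by auto
  show "continuous_on UNIV ?\<psi>"
    by (intro continuous_on_compose2[OF continuous_on_flat_exp[of UNIV]] continuous_intros) auto
  show "0 \<le> ?\<psi> y" for y by (simp add: flat_exp_def)
  have *: "0 < a\<^sup>2 - (norm (y - y0))\<^sup>2 \<longleftrightarrow> y \<in> ball y0 a" for y
    using assms by (auto simp: dist_norm norm_minus_commute power_strict_mono
        intro: power_less_imp_less_base[of _ 2])
  show "0 < ?\<psi> y" if "y \<in> ball y0 a" for y using that * by (simp add: flat_exp_def)
  show "?\<psi> y = 0" if "y \<notin> ball y0 a" for y using that * by (simp add: flat_exp_def)
qed

section \<open>Classes, supports and integrals\<close>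

lemmas moderate_mult = nets_of_rate_mult[OF rate_ideal_moderate, folded moderate_nets_eq]
  and negligible_mult =
    nets_of_rate_mult[OF rate_ideal_negligible, folded moderate_nets_eq negligible_nets_eq]
  and moderate_const = nets_of_rate_const[folded moderate_nets_eq]
  and negligible_zero = nets_of_rate_zero[OF rate_ideal_negligible, folded negligible_nets_eq]
  and negligible_add = nets_of_rate_add[OF rate_ideal_negligible, folded negligible_nets_eq]
  and negligible_diff = nets_of_rate_diff[OF rate_ideal_negligible, folded negligible_nets_eq]
  and moderate_mono = nets_of_rate_mono[of _ moderate_rates, folded moderate_nets_eq]
  and negligible_mono = nets_of_rate_mono[of _ negligible_rates, folded negligible_nets_eq]
  and negligible_local = nets_of_rate_local[OF rate_ideal_negligible, folded negligible_nets_eq]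
  and negligible_cong = nets_of_rate_cong[OF rate_ideal_negligible, folded negligible_nets_eq]
  and moderate_snd = nets_of_rate_snd[OF rate_ideal_moderate, folded moderate_nets_eq]
  and negligible_snd = nets_of_rate_snd[OF rate_ideal_negligible, folded negligible_nets_eq]
  and moderate_set_integral = nets_of_rate_set_integral[OF rate_ideal_moderate, folded moderate_nets_eq]
  and negligible_set_integral =
    nets_of_rate_set_integral[OF rate_ideal_negligible, folded negligible_nets_eq]

lemma negligible_minus_commute:
  assumes "open \<Omega>" "(\<lambda>\<epsilon> x. u \<epsilon> x - v \<epsilon> x) \<in> negligible_nets \<Omega>"
  shows "(\<lambda>\<epsilon> x. v \<epsilon> x - u \<epsilon> x) \<in> negligible_nets \<Omega>"
  using negligible_diff[OF assms(1) negligible_zero[OF assms(1)] assms(2)] by simp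

lemma negligible_minus_trans:
  assumes "open \<Omega>" "(\<lambda>\<epsilon> x. u \<epsilon> x - v \<epsilon> x) \<in> negligible_nets \<Omega>"
    "(\<lambda>\<epsilon> x. v \<epsilon> x - w \<epsilon> x) \<in> negligible_nets \<Omega>"
  shows "(\<lambda>\<epsilon> x. u \<epsilon> x - w \<epsilon> x) \<in> negligible_nets \<Omega>"
  using negligible_add[OF assms] by simp

lemma mem_Cl_iff:
  "v \<in> Cl \<Omega> u \<longleftrightarrow> u \<in> moderate_nets \<Omega> \<and> v \<in> moderate_nets \<Omega> \<and>
    (\<lambda>\<epsilon> x. u \<epsilon> x - v \<epsilon> x) \<in> negligible_nets \<Omega>"
  by (simp add: Cl_def colombeau_rel_def)

lemma Cl_self: "open \<Omega> \<Longrightarrow> u \<in> moderate_nets \<Omega> \<Longrightarrow> u \<in> Cl \<Omega> u"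
  by (simp add: mem_Cl_iff negligible_zero)

text \<open>Moderateness matters: the class of a net that is not moderate is empty.\<close>

lemma Cl_eq_iff:
  assumes "open \<Omega>" "u \<in> moderate_nets \<Omega>" "v \<in> moderate_nets \<Omega>"
  shows "Cl \<Omega> u = Cl \<Omega> v \<longleftrightarrow> (\<lambda>\<epsilon> x. u \<epsilon> x - v \<epsilon> x) \<in> negligible_nets \<Omega>"
proof
  assume "Cl \<Omega> u = Cl \<Omega> v"
  then have "v \<in> Cl \<Omega> u" using Cl_self[OF assms(1,3)] by simp
  then show "(\<lambda>\<epsilon> x. u \<epsilon> x - v \<epsilon> x) \<in> negligible_nets \<Omega>" by (simp add: mem_Cl_iff)
next
  assume *: "(\<lambda>\<epsilon> x. u \<epsilon> x - v \<epsilon> x) \<in> negligible_nets \<Omega>"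
  show "Cl \<Omega> u = Cl \<Omega> v"
  proof (intro set_eqI)
    fix w
    show "w \<in> Cl \<Omega> u \<longleftrightarrow> w \<in> Cl \<Omega> v"
      unfolding mem_Cl_iff
      using assms(2,3) negligible_minus_trans[OF assms(1) *, of w]
        negligible_minus_trans[OF assms(1) negligible_minus_commute[OF assms(1) *], of w] by blast
  qed
qed

lemma Cl_eq_zero_iff:
  assumes "open \<Omega>" "u \<in> moderate_nets \<Omega>"
  shows "Cl \<Omega> u = colombeau_zero \<Omega> \<longleftrightarrow> u \<in> negligible_nets \<Omega>"
  using Cl_eq_iff[OF assms moderate_const[OF assms(1)], of 0] by (simp add: colombeau_zero_def)

lemma colombeau_iff: "U \<in> colombeau \<Omega> \<longleftrightarrow> (\<exists>u\<in>moderate_nets \<Omega>. U = Cl \<Omega> u)"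
  by (auto simp: colombeau_def quotient_def Cl_def)

text \<open>Well-definedness of an operation on classes takes this form: all representatives
  contribute the same class, and there is at least one.\<close>

lemma UN_eq_const:
  assumes "x \<in> A" "\<And>y. y \<in> A \<Longrightarrow> F y = F x"
  shows "(\<Union>y\<in>A. F y) = F x"
  using assms by blast

lemma colombeau_restrict_Cl:
  assumes "open \<Omega>" "open \<Omega>'" "\<Omega>' \<subseteq> \<Omega>" "u \<in> moderate_nets \<Omega>"
  shows "colombeau_restrict \<Omega>' (Cl \<Omega> u) = Cl \<Omega>' u"
  unfolding colombeau_restrict_def
proof (rule UN_eq_const[OF Cl_self[OF assms(1,4)]])
  fix v assume v: "v \<in> Cl \<Omega> u"
  have "(\<lambda>\<epsilon> x. v \<epsilon> x - u \<epsilon> x) \<in> negligible_nets \<Omega>'"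
    using v assms by (auto simp: mem_Cl_iff intro: negligible_mono negligible_minus_commute)
  then show "Cl \<Omega>' v = Cl \<Omega>' u"
    using v assms by (subst Cl_eq_iff) (auto simp: mem_Cl_iff intro: moderate_mono)
qed

lemma colombeau_mult_Cl:
  assumes "open \<Omega>" "u \<in> moderate_nets \<Omega>" "v \<in> moderate_nets \<Omega>"
  shows "colombeau_mult \<Omega> (Cl \<Omega> u) (Cl \<Omega> v) = Cl \<Omega> (\<lambda>\<epsilon> x. u \<epsilon> x * v \<epsilon> x)"
proof -
  have *: "Cl \<Omega> (\<lambda>\<epsilon> x. u' \<epsilon> x * v' \<epsilon> x) = Cl \<Omega> (\<lambda>\<epsilon> x. u \<epsilon> x * v \<epsilon> x)"
    if "u' \<in> Cl \<Omega> u" "v' \<in> Cl \<Omega> v" for u' v'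
  proof -
    have mod: "u' \<in> moderate_nets \<Omega>" "v' \<in> moderate_nets \<Omega>"
      and neg: "(\<lambda>\<epsilon> x. u' \<epsilon> x - u \<epsilon> x) \<in> negligible_nets \<Omega>" "(\<lambda>\<epsilon> x. v' \<epsilon> x - v \<epsilon> x) \<in> negligible_nets \<Omega>"
      using that assms(1) by (auto simp: mem_Cl_iff intro: negligible_minus_commute)
    \<comment> \<open>This splits \<open>u' * v' - u * v\<close> so that each summand has a moderate
      and a negligible factor.\<close>
    have "(\<lambda>\<epsilon> x. u' \<epsilon> x * (v' \<epsilon> x - v \<epsilon> x) + v \<epsilon> x * (u' \<epsilon> x - u \<epsilon> x)) \<in> negligible_nets \<Omega>"
      using mod neg assms by (intro negligible_add negligible_mult)
    then have "(\<lambda>\<epsilon> x. u' \<epsilon> x * v' \<epsilon> x - u \<epsilon> x * v \<epsilon> x) \<in> negligible_nets \<Omega>"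
      by (simp add: algebra_simps)
    then show ?thesis using mod assms by (subst Cl_eq_iff) (auto intro: moderate_mult)
  qed
  have "colombeau_mult \<Omega> (Cl \<Omega> u) (Cl \<Omega> v) = (\<Union>u'\<in>Cl \<Omega> u. Cl \<Omega> (\<lambda>\<epsilon> x. u \<epsilon> x * v \<epsilon> x))"
    unfolding colombeau_mult_def
  proof (rule SUP_cong)
    fix u' assume u': "u' \<in> Cl \<Omega> u"
    show "(\<Union>v\<in>Cl \<Omega> v. Cl \<Omega> (\<lambda>\<epsilon> x. u' \<epsilon> x * v \<epsilon> x)) = Cl \<Omega> (\<lambda>\<epsilon> x. u \<epsilon> x * v \<epsilon> x)"
      using *[OF u'] Cl_self[OF assms(1,3)] by blast
  qed simp
  then show ?thesis using Cl_self[OF assms(1,2)] by blast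
qed

lemma colombeau_pullback_snd_Cl:
  assumes "open X" "open Y" "f \<in> moderate_nets Y"
  shows "colombeau_pullback_snd X Y (Cl Y f) = Cl (X \<times> Y) (\<lambda>\<epsilon> z. f \<epsilon> (snd z))"
proof -
  have "(\<Union>f\<in>Cl Y f. Cl (X \<times> Y) (\<lambda>\<epsilon> z. f \<epsilon> (snd z))) = Cl (X \<times> Y) (\<lambda>\<epsilon> z. f \<epsilon> (snd z))"
  proof (rule UN_eq_const[OF Cl_self[OF assms(2,3)]])
    fix g assume g: "g \<in> Cl Y f"
    have "(\<lambda>\<epsilon> z. g \<epsilon> (snd z) - f \<epsilon> (snd z)) \<in> negligible_nets (X \<times> Y)"
      using negligible_snd[OF assms(1,2), of "\<lambda>\<epsilon> y. g \<epsilon> y - f \<epsilon> y"] g assms(2)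
      by (auto simp: mem_Cl_iff intro: negligible_minus_commute)
    then show "Cl (X \<times> Y) (\<lambda>\<epsilon> z. g \<epsilon> (snd z)) = Cl (X \<times> Y) (\<lambda>\<epsilon> z. f \<epsilon> (snd z))"
      using g assms by (subst Cl_eq_iff) (auto simp: mem_Cl_iff intro!: open_Times moderate_snd)
  qed
  then show ?thesis by (simp add: colombeau_pullback_snd_def case_prod_beta')
qed

lemma colombeau_supp_Cl:
  assumes "open \<Omega>" "u \<in> moderate_nets \<Omega>"
  shows "colombeau_supp \<Omega> (Cl \<Omega> u) = \<Omega> - \<Union>{W. open W \<and> W \<subseteq> \<Omega> \<and> u \<in> negligible_nets W}"
proof -
  have "colombeau_restrict W (Cl \<Omega> u) = colombeau_zero W \<longleftrightarrow> u \<in> negligible_nets W"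
    if "open W" "W \<subseteq> \<Omega>" for W
    using that assms by (simp add: colombeau_restrict_Cl Cl_eq_zero_iff moderate_mono)
  then show ?thesis unfolding colombeau_supp_def by (metis (no_types, lifting))
qed

text \<open>Off the support every point has a neighbourhood on which \<open>u\<close> is negligible,
  and negligibility is local. The union in the definition of the support is thus itself
  admissible.\<close>

lemma negligible_off_supp:
  assumes "open \<Omega>" "u \<in> moderate_nets \<Omega>"
  shows "u \<in> negligible_nets (\<Omega> - colombeau_supp \<Omega> (Cl \<Omega> u))"
  by (rule negligible_local) (auto simp: colombeau_supp_Cl[OF assms])

section \<open>The integral and the operator on representatives\<close>

text \<open>When one \<open>W0\<close> captures the support over all of \<open>X\<close>, its
  integral meets every local condition of the definite description: two admissible domains differ
  only where \<open>u\<close> is negligible. Uniqueness is locality of negligibility on small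
  balls.\<close>

lemma colombeau_integral_Cl:
  assumes X: "open X" and Y: "open Y" and u: "u \<in> moderate_nets (X \<times> Y)"
    and W0: "rel_compact_open W0 Y" and supp: "colombeau_supp (X \<times> Y) (Cl (X \<times> Y) u) \<subseteq> X \<times> W0"
  shows "colombeau_integral X Y (Cl (X \<times> Y) u) = Cl X (\<lambda>\<epsilon> x. LINT y:W0|lborel. u \<epsilon> (x, y))"
proof -
  let ?I = "\<lambda>W u \<epsilon> x. LINT y:W|lborel. u \<epsilon> (x, y)"
  let ?U = "Cl (X \<times> Y) u"
  let ?S = "colombeau_supp (X \<times> Y) ?U"
  have XY: "open (X \<times> Y)" using X Y by (rule open_Times)
  have modI: "?I W g \<in> moderate_nets X" if "rel_compact_open W Y" "g \<in> moderate_nets (X \<times> Y)" for W g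
    by (rule moderate_set_integral[OF X that(2), of "closure W"])
       (use that closure_subset in \<open>auto simp: rel_compact_open_def\<close>)
  have int: "set_integrable lborel B (\<lambda>y. g \<epsilon> (x, y))"
    if "rel_compact_open W Y" "g \<in> moderate_nets (X \<times> Y)" "0 < \<epsilon>" "\<epsilon> \<le> 1" "x \<in> X" "B \<in> sets borel" "B \<subseteq> W"
    for W g \<epsilon> x B
  proof (rule set_integrable_continuous[of "closure W"])
    have "continuous_on (X \<times> Y) (g \<epsilon>)"
      using that unfolding moderate_nets_eq by (intro smooth_on_continuous0 nets_of_rate_smooth)
    then show "continuous_on (closure W) (\<lambda>y. g \<epsilon> (x, y))"
      by (rule continuous_on_compose2) (use that in \<open>auto simp: rel_compact_open_def intro!: continuous_intros\<close>)
  qed (use that closure_subset in \<open>auto simp: rel_compact_open_def\<close>)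
  have dom: "(\<lambda>\<epsilon> x. ?I W0 u \<epsilon> x - ?I W g \<epsilon> x) \<in> negligible_nets O1"
    if O1: "rel_compact_open O1 X" and W: "rel_compact_open W Y" and S: "?S \<inter> (O1 \<times> Y) \<subseteq> O1 \<times> W"
      and g: "g \<in> ?U" for O1 W g
  proof (rule negligible_cong)
    have o: "open O1" "O1 \<subseteq> X" "open W" "open W0"
      and c: "compact (closure W)" "closure W \<subseteq> Y" "compact (closure W0)" "closure W0 \<subseteq> Y"
      using O1 W W0 closure_subset unfolding rel_compact_open_def by blast+
    have g': "g \<in> moderate_nets (X \<times> Y)" "(\<lambda>\<epsilon> z. u \<epsilon> z - g \<epsilon> z) \<in> negligible_nets (X \<times> Y)"
      using g by (auto simp: mem_Cl_iff)
    show "open O1" by fact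
    \<comment> \<open>The difference \<open>?I W0 u - ?I W g\<close> is split into the parts over
      \<open>W0 - W\<close> and \<open>W - W0\<close> and the change of representative over
      \<open>W\<close>. As \<open>W\<close> is open, \<open>closure W0 - W\<close> is compact, and
      over \<open>O1\<close> it avoids the support.\<close>
    have 1: "?I (W0 - W) u \<in> negligible_nets O1"
      by (rule negligible_set_integral[OF o(1) negligible_off_supp[OF XY u], of "closure W0 - W"])
         (use o c S closure_subset[of W0] in \<open>auto intro!: compact_diff\<close>)
    have 2: "?I (W - W0) u \<in> negligible_nets O1"
      by (rule negligible_set_integral[OF o(1) negligible_off_supp[OF XY u], of "closure W - W0"])
         (use o c supp closure_subset[of W] in \<open>auto intro!: compact_diff\<close>)
    have 3: "?I W (\<lambda>\<epsilon> z. u \<epsilon> z - g \<epsilon> z) \<in> negligible_nets O1"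
      by (rule negligible_set_integral[OF o(1) g'(2), of "closure W"])
         (use o c closure_subset[of W] in auto)
    show "(\<lambda>\<epsilon> x. ?I (W0 - W) u \<epsilon> x - ?I (W - W0) u \<epsilon> x + ?I W (\<lambda>\<epsilon> z. u \<epsilon> z - g \<epsilon> z) \<epsilon> x)
        \<in> negligible_nets O1"
      by (intro negligible_add negligible_diff o 1 2 3)
    fix \<epsilon> :: real and x assume e: "0 < \<epsilon>" "\<epsilon> \<le> 1" "x \<in> O1"
    then have x: "x \<in> X" using o by blast
    let ?B = "W \<inter> W0"
    have disj: "(A - B) \<inter> (A \<inter> B) = {}" for A B :: "'b set" by blast
    have bor: "W \<in> sets borel" "W0 \<in> sets borel" using o by auto
    have iW: "?I W u \<epsilon> x = ?I (W - W0) u \<epsilon> x + ?I ?B u \<epsilon> x"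
      using set_integral_Un[of "W - W0" ?B lborel "\<lambda>y. u \<epsilon> (x, y)"]
        int[OF W u e(1,2) x, of "W - W0"] int[OF W u e(1,2) x, of ?B] bor
      by (simp add: Un_Diff_Int disj)
    have iW0: "?I W0 u \<epsilon> x = ?I (W0 - W) u \<epsilon> x + ?I ?B u \<epsilon> x"
      using set_integral_Un[of "W0 - W" ?B lborel "\<lambda>y. u \<epsilon> (x, y)"]
        int[OF W0 u e(1,2) x, of "W0 - W"] int[OF W0 u e(1,2) x, of ?B] bor
      by (simp add: Un_Diff_Int Int_commute[of W] disj)
    have "?I W (\<lambda>\<epsilon> z. u \<epsilon> z - g \<epsilon> z) \<epsilon> x = ?I W u \<epsilon> x - ?I W g \<epsilon> x"
      using int[OF W u e(1,2) x bor(1)] int[OF W g'(1) e(1,2) x bor(1)] by simp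
    then show "?I W0 u \<epsilon> x - ?I W g \<epsilon> x =
        ?I (W0 - W) u \<epsilon> x - ?I (W - W0) u \<epsilon> x + ?I W (\<lambda>\<epsilon> z. u \<epsilon> z - g \<epsilon> z) \<epsilon> x"
      using iW iW0 by simp
  qed
  show ?thesis
    unfolding colombeau_integral_def
  proof (rule the_equality)
    show "Cl X (?I W0 u) \<in> colombeau X \<and> (\<forall>O1 W. rel_compact_open O1 X \<and> rel_compact_open W Y \<and>
        ?S \<inter> O1 \<times> Y \<subseteq> O1 \<times> W \<longrightarrow> (\<forall>g\<in>?U. colombeau_restrict O1 (Cl X (?I W0 u)) = Cl O1 (?I W g)))"
    proof (intro conjI allI impI ballI)
      show "Cl X (?I W0 u) \<in> colombeau X"
        using modI[OF W0 u] by (auto simp: colombeau_iff)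
      fix O1 W g
      assume A: "rel_compact_open O1 X \<and> rel_compact_open W Y \<and> ?S \<inter> O1 \<times> Y \<subseteq> O1 \<times> W" and g: "g \<in> ?U"
      then have o: "open O1" "O1 \<subseteq> X" using closure_subset unfolding rel_compact_open_def by blast+
      have "Cl O1 (?I W0 u) = Cl O1 (?I W g)"
        using A g dom[of O1 W g] modI[OF W0 u] modI[of W g] o
        by (subst Cl_eq_iff) (auto simp: mem_Cl_iff intro: moderate_mono)
      then show "colombeau_restrict O1 (Cl X (?I W0 u)) = Cl O1 (?I W g)"
        using colombeau_restrict_Cl[OF X o modI[OF W0 u]] by simp
    qed
  next
    fix G assume G: "G \<in> colombeau X \<and> (\<forall>O1 W. rel_compact_open O1 X \<and> rel_compact_open W Y \<and>
        ?S \<inter> O1 \<times> Y \<subseteq> O1 \<times> W \<longrightarrow> (\<forall>g\<in>?U. colombeau_restrict O1 G = Cl O1 (?I W g)))"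
    then obtain v where v: "v \<in> moderate_nets X" "G = Cl X v" by (auto simp: colombeau_iff)
    \<comment> \<open>Every point of \<open>X\<close> lies in a relatively compact ball, where the
      defining condition with \<open>W = W0\<close> fixes the class of \<open>v\<close>.\<close>
    have "(\<lambda>\<epsilon> x. v \<epsilon> x - ?I W0 u \<epsilon> x) \<in> negligible_nets X"
    proof (rule negligible_local)
      fix x assume "x \<in> X"
      then obtain r where r: "r > 0" "cball x r \<subseteq> X" using X open_contains_cball by blast
      let ?O = "ball x r"
      have rc: "rel_compact_open ?O X" using r by (simp add: rel_compact_open_def)
      have "?S \<inter> ?O \<times> Y \<subseteq> ?O \<times> W0" using supp by auto
      then have "colombeau_restrict ?O G = Cl ?O (?I W0 u)"
        using G rc W0 Cl_self[OF XY u] by blast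
      moreover have "?O \<subseteq> X" using r ball_subset_cball by blast
      ultimately have "(\<lambda>\<epsilon> x. v \<epsilon> x - ?I W0 u \<epsilon> x) \<in> negligible_nets ?O"
        using v modI[OF W0 u] colombeau_restrict_Cl[OF X open_ball _ v(1), of x r]
          Cl_eq_iff[of ?O v "?I W0 u"] by (auto intro: moderate_mono)
      then show "\<exists>V. open V \<and> x \<in> V \<and> (\<lambda>\<epsilon> x. v \<epsilon> x - ?I W0 u \<epsilon> x) \<in> negligible_nets V"
        using r by (intro exI[of _ ?O]) auto
    qed
    then show "G = Cl X (?I W0 u)" using v modI[OF W0 u] X by (simp add: Cl_eq_iff)
  qed
qed

text \<open>The support condition concerns the product of kernel and argument, so a compactly
  supported \<open>f\<close> can satisfy it with a \<open>W0\<close> that does not depend on the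
  kernel.\<close>

lemma gen_integral_op_Cl:
  assumes X: "open X" and Y: "open Y" and h: "h \<in> moderate_nets (X \<times> Y)" and f: "f \<in> moderate_nets Y"
    and W0: "rel_compact_open W0 Y"
    and supp: "colombeau_supp (X \<times> Y) (Cl (X \<times> Y) (\<lambda>\<epsilon> z. h \<epsilon> z * f \<epsilon> (snd z))) \<subseteq> X \<times> W0"
  shows "gen_integral_op X Y (Cl (X \<times> Y) h) (Cl Y f) =
    Cl X (\<lambda>\<epsilon> x. LINT y:W0|lborel. h \<epsilon> (x, y) * f \<epsilon> y)"
proof -
  have XY: "open (X \<times> Y)" using X Y by (rule open_Times)
  have mod: "(\<lambda>\<epsilon> z. h \<epsilon> z * f \<epsilon> (snd z)) \<in> moderate_nets (X \<times> Y)"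
    by (intro moderate_mult XY h moderate_snd X Y f)
  have "gen_integral_op X Y (Cl (X \<times> Y) h) (Cl Y f) =
      colombeau_integral X Y (Cl (X \<times> Y) (\<lambda>\<epsilon> z. h \<epsilon> z * f \<epsilon> (snd z)))"
    by (simp add: gen_integral_op_def colombeau_pullback_snd_Cl[OF X Y f]
        colombeau_mult_Cl[OF XY h moderate_snd[OF X Y f]])
  also have "\<dots> = Cl X (\<lambda>\<epsilon> x. LINT y:W0|lborel. h \<epsilon> (x, y) * f \<epsilon> y)"
    using colombeau_integral_Cl[OF X Y mod W0 supp] by simp
  finally show ?thesis .
qed

text \<open>The product of a negligible kernel with a moderate net has empty support, so the
  integral may be taken over the empty set.\<close>

lemma gen_integral_op_zero:
  assumes X: "open X" and Y: "open Y" and h: "h \<in> negligible_nets (X \<times> Y)" and f: "f \<in> moderate_nets Y"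
  shows "gen_integral_op X Y (Cl (X \<times> Y) h) (Cl Y f) = colombeau_zero X"
proof -
  have XY: "open (X \<times> Y)" using X Y by (rule open_Times)
  have h': "h \<in> moderate_nets (X \<times> Y)"
    using h negligible_subset_moderate_nets unfolding moderate_nets_eq negligible_nets_eq by blast
  have hf: "(\<lambda>\<epsilon> z. h \<epsilon> z * f \<epsilon> (snd z)) \<in> negligible_nets (X \<times> Y)"
    using negligible_mult[OF XY moderate_snd[OF X Y f] h] by (simp add: mult.commute)
  have "(\<lambda>\<epsilon> z. h \<epsilon> z * f \<epsilon> (snd z)) \<in> moderate_nets (X \<times> Y)"
    by (intro moderate_mult XY h' moderate_snd X Y f)
  then have "colombeau_supp (X \<times> Y) (Cl (X \<times> Y) (\<lambda>\<epsilon> z. h \<epsilon> z * f \<epsilon> (snd z))) \<subseteq> X \<times> {}"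
    using hf XY by (subst colombeau_supp_Cl) auto
  then have "gen_integral_op X Y (Cl (X \<times> Y) h) (Cl Y f) =
      Cl X (\<lambda>\<epsilon> x. LINT y:{}|lborel. h \<epsilon> (x, y) * f \<epsilon> y)"
    by (intro gen_integral_op_Cl X Y h' f) (auto simp: rel_compact_open_def)
  then show ?thesis by (simp add: set_lebesgue_integral_def colombeau_zero_def)
qed

section \<open>The kernel of a vanishing operator\<close>

text \<open>Mean value inequality on a convex set; the first order seminorm bounds each partial
  derivative, and summing over the basis costs a factor equal to the dimension.\<close>

lemma moderate_lipschitz:
  assumes u: "u \<in> nets_of_rate moderate_rates \<Omega>" and K: "compact K" "convex K" "K \<subseteq> \<Omega>"
  obtains C n where "C > 0"
    "\<forall>\<^sub>F \<epsilon> in at_right 0. \<forall>x\<in>K. \<forall>y\<in>K. cmod (u \<epsilon> x - u \<epsilon> y) \<le> C / \<epsilon> ^ n * dist x y"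
proof -
  let ?s = "\<lambda>\<epsilon>. real DIM('a) * seminorm_p K 1 (u \<epsilon>)"
  have "(\<lambda>\<epsilon>. seminorm_p K 1 (u \<epsilon>)) \<in> moderate_rates"
    using u K unfolding nets_of_rate_def by blast
  then have "?s \<in> moderate_rates"
    by (rule rate_ideal_mult[OF rate_ideal_moderate moderate_rates_const])
  then obtain C n where C: "C > 0" "\<forall>\<^sub>F \<epsilon> in at_right 0. \<bar>?s \<epsilon>\<bar> \<le> C / \<epsilon> ^ n"
    by (rule moderate_ratesD)
  have "\<forall>\<^sub>F \<epsilon> in at_right 0. \<forall>x\<in>K. \<forall>y\<in>K. cmod (u \<epsilon> x - u \<epsilon> y) \<le> C / \<epsilon> ^ n * dist x y"
    using C(2) eventually_unit
  proof eventually_elim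
    case (elim \<epsilon>)
    have sm: "smooth_on \<Omega> (u \<epsilon>)" using u elim by (auto intro: nets_of_rate_smooth)
    show ?case
    proof (intro ballI)
      fix x y assume xy: "x \<in> K" "y \<in> K"
      have "cmod (u \<epsilon> x - u \<epsilon> y) \<le> ?s \<epsilon> * norm (x - y)"
      proof (rule differentiable_bound[OF K(2) _ _ xy])
        fix z assume z: "z \<in> K"
        show "(u \<epsilon> has_derivative (\<lambda>h. \<Sum>b\<in>Basis. (h \<bullet> b) *\<^sub>R partial_deriv b (u \<epsilon>) z)) (at z within K)"
          using z K by (intro has_derivative_at_withinI[OF smooth_on_has_derivative[OF sm]]) auto
        show "onorm (\<lambda>h. \<Sum>b\<in>Basis. (h \<bullet> b) *\<^sub>R partial_deriv b (u \<epsilon>) z) \<le> ?s \<epsilon>"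
        proof (rule onorm_le)
          fix h :: 'a
          have "cmod ((h \<bullet> b) *\<^sub>R partial_deriv b (u \<epsilon>) z) \<le> norm h * seminorm_p K 1 (u \<epsilon>)"
            if b: "b \<in> Basis" for b
            using le_seminorm_p[OF sm K(1,3) z, of "[b]" 1] b
            by (auto simp: iter_partial_simps intro!: mult_mono Basis_le_norm)
          then have "cmod (\<Sum>b\<in>Basis. (h \<bullet> b) *\<^sub>R partial_deriv b (u \<epsilon>) z) \<le>
              (\<Sum>b\<in>(Basis::'a set). norm h * seminorm_p K 1 (u \<epsilon>))"
            by (intro sum_norm_le)
          then show "cmod (\<Sum>b\<in>Basis. (h \<bullet> b) *\<^sub>R partial_deriv b (u \<epsilon>) z) \<le> ?s \<epsilon> * norm h"
            by (simp add: mult_ac)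
        qed
      qed
      also have "\<dots> \<le> C / \<epsilon> ^ n * norm (x - y)"
        using elim(1) by (intro mult_right_mono) auto
      finally show "cmod (u \<epsilon> x - u \<epsilon> y) \<le> C / \<epsilon> ^ n * dist x y" by (simp add: dist_norm)
    qed
  qed
  with C(1) show thesis by (rule that)
qed

text \<open>A Chebyshev type bound, used to convert a small integral into a small value on a ball of
  known volume.\<close>

lemma measure_le_set_integral:
  fixes \<phi> :: "'b::euclidean_space \<Rightarrow> real"
  assumes "compact C" "continuous_on C \<phi>" "B \<in> sets borel" "B \<subseteq> C" "A \<in> sets borel" "A \<subseteq> B"
    "\<And>y. y \<in> B \<Longrightarrow> 0 \<le> \<phi> y" "\<And>y. y \<in> A \<Longrightarrow> m \<le> \<phi> y"
  shows "m * measure lborel A \<le> (LINT y:B|lborel. \<phi> y)"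
proof -
  have "emeasure lborel A \<le> emeasure lborel C"
    using assms borel_compact[OF assms(1)] by (intro emeasure_mono) auto
  then have "emeasure lborel A < \<infinity>" using emeasure_compact_finite[OF assms(1)] by (rule le_less_trans)
  then have "integrable lborel (\<lambda>y. m * indicator A y)" using assms(5) by simp
  then have "(\<integral>y. m * indicator A y \<partial>lborel) \<le> (LINT y:B|lborel. \<phi> y)"
    unfolding set_lebesgue_integral_def
    using set_integrable_continuous[OF assms(1-4)] assms(6-8)
    by (intro integral_mono) (auto simp: set_integrable_def split: split_indicator)
  then show ?thesis by simp
qed

lemma kernel_negligible_near:
  fixes X :: "'a::euclidean_space set" and Y :: "'b::euclidean_space set"
  assumes X: "open X" and Y: "open Y" and h: "h \<in> moderate_nets (X \<times> Y)"
    and zero: "\<And>f. f \<in> moderate_nets Y \<Longrightarrow> gen_integral_op X Y (Cl (X \<times> Y) h) (Cl Y f) = colombeau_zero X"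
    and x0: "x0 \<in> X" and y0: "y0 \<in> Y"
  shows "\<exists>V. open V \<and> (x0, y0) \<in> V \<and> h \<in> negligible_nets V"
proof -
  have XY: "open (X \<times> Y)" using X Y by (rule open_Times)
  obtain rx ry where rx: "rx > 0" "cball x0 rx \<subseteq> X" and ry: "ry > 0" "cball y0 ry \<subseteq> Y"
    using X Y x0 y0 open_contains_cball by metis
  \<comment> \<open>Nested radii in \<open>Y\<close>: maximisers lie within \<open>r\<close>, balls
    of radius at most \<open>r\<close> around them within \<open>2 * r\<close>, where the bump is
    bounded below; the bump vanishes outside \<open>3 * r\<close>, and the integral runs over
    \<open>4 * r\<close>, still inside \<open>Y\<close>.\<close>
  define r where "r = min rx (ry / 4)"
  have r: "r > 0" "cball x0 r \<subseteq> X" "cball y0 (4 * r) \<subseteq> Y"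
    using rx ry by (auto simp: r_def subset_iff)
  obtain \<psi> :: "'b \<Rightarrow> real" where \<psi>: "(\<lambda>\<epsilon> y. complex_of_real (\<psi> y)) \<in> nets_of_rate moderate_rates UNIV"
    "continuous_on UNIV \<psi>" "\<And>y. 0 \<le> \<psi> y" "\<And>y. y \<in> ball y0 (3 * r) \<Longrightarrow> 0 < \<psi> y"
    "\<And>y. y \<notin> ball y0 (3 * r) \<Longrightarrow> \<psi> y = 0"
    using smooth_bump[of "3 * r" y0] r(1) by auto
  obtain c where c: "c > 0" "\<And>y. y \<in> cball y0 (2 * r) \<Longrightarrow> c \<le> \<psi> y"
  proof -
    have "continuous_on (cball y0 (2 * r)) \<psi>" using \<psi>(2) continuous_on_subset by blast
    then obtain y1 where "y1 \<in> cball y0 (2 * r)" "\<And>y. y \<in> cball y0 (2 * r) \<Longrightarrow> \<psi> y1 \<le> \<psi> y"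
      using continuous_attains_inf[of "cball y0 (2 * r)" \<psi>] r(1) by auto
    then show thesis using \<psi>(4)[of y1] r(1) by (intro that[of "\<psi> y1"]) auto
  qed
  let ?Q = "cball x0 r \<times> cball y0 r"
  have Q: "compact ?Q" "?Q \<noteq> {}" "?Q \<subseteq> X \<times> Y"
    using r by (auto intro!: compact_Times)
  have conth: "continuous_on (X \<times> Y) (h \<epsilon>)" if "0 < \<epsilon>" "\<epsilon> \<le> 1" for \<epsilon>
    using h that unfolding moderate_nets_eq by (intro smooth_on_continuous0 nets_of_rate_smooth)
  have "\<exists>z\<in>?Q. \<forall>z'\<in>?Q. cmod (h \<epsilon> z') \<le> cmod (h \<epsilon> z)" if "0 < \<epsilon>" "\<epsilon> \<le> 1" for \<epsilon>
    by (rule continuous_attains_sup[OF Q(1,2)])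
       (rule continuous_on_norm[OF continuous_on_subset[OF conth[OF that] Q(3)]])
  \<comment> \<open>Nets carry no regularity in \<open>\<epsilon>\<close>, so a maximiser may be
    chosen for each \<open>\<epsilon>\<close> independently.\<close>
  then obtain p where p: "\<And>\<epsilon>. 0 < \<epsilon> \<Longrightarrow> \<epsilon> \<le> 1 \<Longrightarrow> p \<epsilon> \<in> ?Q"
    "\<And>\<epsilon> z. 0 < \<epsilon> \<Longrightarrow> \<epsilon> \<le> 1 \<Longrightarrow> z \<in> ?Q \<Longrightarrow> cmod (h \<epsilon> z) \<le> cmod (h \<epsilon> (p \<epsilon>))"
    by metis
  define k where "k \<epsilon> y = h \<epsilon> (fst (p \<epsilon>), y)" for \<epsilon> y
  have k: "k \<in> nets_of_rate moderate_rates Y"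
    unfolding k_def
  proof (rule nets_of_rate_section[OF rate_ideal_moderate X Y h[unfolded moderate_nets_eq] compact_cball r(2)])
    show "fst (p \<epsilon>) \<in> cball x0 r" if "0 < \<epsilon>" "\<epsilon> \<le> 1" for \<epsilon>
      using p(1)[OF that] by (simp add: mem_Times_iff)
  qed
  have "(\<lambda>\<epsilon> y. cnj (k \<epsilon> y)) \<in> moderate_nets Y" "(\<lambda>\<epsilon> y. complex_of_real (\<psi> y)) \<in> moderate_nets Y"
    unfolding moderate_nets_eq
    using nets_of_rate_cnj[OF rate_ideal_moderate Y k] nets_of_rate_mono[OF \<psi>(1)] by auto
  then have f: "(\<lambda>\<epsilon> y. cnj (k \<epsilon> y) * complex_of_real (\<psi> y)) \<in> moderate_nets Y" (is "?f \<in> _")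
    by (rule moderate_mult[OF Y])
  let ?W = "ball y0 (4 * r)"
  have W: "rel_compact_open ?W Y" using r by (simp add: rel_compact_open_def)
  define I where "I \<epsilon> x = (LINT y:?W|lborel. h \<epsilon> (x, y) * ?f \<epsilon> y)" for \<epsilon> x
  have "gen_integral_op X Y (Cl (X \<times> Y) h) (Cl Y ?f) = Cl X I"
    unfolding I_def
  proof (rule gen_integral_op_Cl[OF X Y h f W])
    let ?u = "\<lambda>\<epsilon> z. h \<epsilon> z * ?f \<epsilon> (snd z)"
    have u: "?u \<in> moderate_nets (X \<times> Y)"
      by (rule moderate_mult[OF XY h moderate_snd[OF X Y f]])
    \<comment> \<open>The bump vanishes on this open set, which confines the support of the product
      to the closed ball of radius \<open>3 * r\<close>, inside the open ball
      \<open>?W\<close>.\<close>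
    let ?V = "X \<times> (Y - cball y0 (3 * r))"
    have V: "open ?V" "?V \<subseteq> X \<times> Y" using X Y by (auto intro!: open_Times)
    have "?u \<in> negligible_nets ?V"
      by (rule negligible_cong[OF V(1) negligible_zero[OF V(1)]]) (auto simp: \<psi>(5))
    then have "colombeau_supp (X \<times> Y) (Cl (X \<times> Y) ?u) \<subseteq> X \<times> Y - ?V"
      using V unfolding colombeau_supp_Cl[OF XY u] by blast
    also have "\<dots> \<subseteq> X \<times> ?W" using r(1) by auto
    finally show "colombeau_supp (X \<times> Y) (Cl (X \<times> Y) ?u) \<subseteq> X \<times> ?W" .
  qed
  then have "Cl X I = colombeau_zero X" using zero[OF f] by simp
  moreover have "I \<in> moderate_nets X"
    unfolding I_def
    using moderate_set_integral[OF X moderate_mult[OF XY h moderate_snd[OF X Y f]], of "cball y0 (4 * r)" ?W] r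
    by auto
  ultimately have I: "I \<in> nets_of_rate negligible_rates X"
    using X by (simp add: Cl_eq_zero_iff negligible_nets_eq)
  have "cball y0 (2 * r) \<subseteq> Y" using r by (auto simp: subset_iff)
  from moderate_lipschitz[OF k compact_cball convex_cball this]
  obtain L m where L: "L > 0" "\<forall>\<^sub>F \<epsilon> in at_right 0. \<forall>x\<in>cball y0 (2 * r). \<forall>y\<in>cball y0 (2 * r).
      cmod (k \<epsilon> x - k \<epsilon> y) \<le> L / \<epsilon> ^ m * dist x y" by blast
  have sup: "\<exists>C. \<forall>\<^sub>F \<epsilon> in at_right 0. cmod (h \<epsilon> (p \<epsilon>)) \<le> C * \<epsilon> ^ n" for n
  proof -
    let ?d = "DIM('b)"
    \<comment> \<open>\<open>2 * n\<close> because the square of the maximum gets estimated,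
      \<open>(m + n) * ?d\<close> for the volume of a ball of radius
      \<open>r * \<epsilon> ^ (m + n)\<close>.\<close>
    define q where "q = 2 * n + (m + n) * ?d"
    obtain D where D: "D > 0" "\<forall>\<^sub>F \<epsilon> in at_right 0. \<forall>x\<in>cball x0 r. cmod (I \<epsilon> x) \<le> D * \<epsilon> ^ q"
      by (rule bounded_at_negligible_rateD[OF nets_of_rate_bounded[OF rate_ideal_negligible I compact_cball r(2)]])
    \<comment> \<open>The volume of a ball of radius \<open>r\<close>.\<close>
    define v where "v = unit_ball_vol (real ?d) * r ^ ?d"
    have v: "v > 0" using r(1) by (simp add: v_def)
    \<comment> \<open>The 4 comes from squaring the lower bound \<open>s / 2\<close>.\<close>
    define E where "E = 4 * D / (c * v)"
    have E: "E > 0" using D(1) c(1) v by (simp add: E_def)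
    have "\<forall>\<^sub>F \<epsilon> in at_right 0. cmod (h \<epsilon> (p \<epsilon>)) \<le> (2 * L * r + (1 + E)) * \<epsilon> ^ n"
      using D(2) L(2) eventually_unit
    proof eventually_elim
      case (elim \<epsilon>)
      then have e: "0 < \<epsilon>" "\<epsilon> \<le> 1" by auto
      obtain xe ye where pe: "p \<epsilon> = (xe, ye)" by fastforce
      have xye: "xe \<in> cball x0 r" "ye \<in> cball y0 r" using p(1)[OF e] pe by auto
      define s where "s = cmod (h \<epsilon> (p \<epsilon>))"
      have ks: "cmod (k \<epsilon> ye) = s" by (simp add: s_def k_def pe)
      \<comment> \<open>The first alternative is the case where the maximum is already small.
        Otherwise the variation of \<open>k \<epsilon>\<close> over a ball of radius
        \<open>\<rho>\<close>, at most \<open>L * r * \<epsilon> ^ n\<close>, is below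
        \<open>s / 2\<close>, and the integral estimate applies.\<close>
      have "s \<le> 2 * L * r * \<epsilon> ^ n \<or> s \<le> (1 + E) * \<epsilon> ^ n"
      proof (cases "s \<le> 2 * L * r * \<epsilon> ^ n")
        case False
        define \<rho> where "\<rho> = r * \<epsilon> ^ (m + n)"
        have \<rho>: "\<rho> > 0" "\<rho> \<le> r" using e r by (auto simp: \<rho>_def power_le_one mult_left_le)
        have L\<rho>: "L / \<epsilon> ^ m * \<rho> = L * r * \<epsilon> ^ n" using e by (simp add: \<rho>_def power_add)
        have sub: "ball ye \<rho> \<subseteq> cball y0 (2 * r)"
        proof
          fix y assume "y \<in> ball ye \<rho>"
          then show "y \<in> cball y0 (2 * r)"
            using xye(2) \<rho> dist_triangle[of y0 y ye] by simp
        qed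
        have kl: "s / 2 \<le> cmod (k \<epsilon> y)" if y: "y \<in> ball ye \<rho>" for y
        proof -
          have "ye \<in> cball y0 (2 * r)" using xye(2) r(1) by simp
          then have "cmod (k \<epsilon> ye - k \<epsilon> y) \<le> L / \<epsilon> ^ m * dist ye y"
            using elim(2) sub y by blast
          also have "\<dots> \<le> L / \<epsilon> ^ m * \<rho>" using y L(1) e by (intro mult_left_mono) auto
          also have "\<dots> < s / 2" using L\<rho> False by simp
          finally show ?thesis using ks norm_triangle_sub[of "k \<epsilon> ye" "k \<epsilon> y"] by simp
        qed
        let ?\<phi> = "\<lambda>y. (cmod (k \<epsilon> y))\<^sup>2 * \<psi> y"
        have "h \<epsilon> (xe, y) * ?f \<epsilon> y = complex_of_real (?\<phi> y)" for y
          using complex_norm_square[of "h \<epsilon> (xe, y)"] by (simp add: k_def pe)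
        then have "I \<epsilon> xe = complex_of_real (LINT y:?W|lborel. ?\<phi> y)"
          unfolding I_def by (simp only: set_integral_complex_of_real)
        moreover have "(s / 2)\<^sup>2 * c * measure lborel (ball ye \<rho>) \<le> (LINT y:?W|lborel. ?\<phi> y)"
        proof (rule measure_le_set_integral[of "cball y0 (4 * r)"])
          have "continuous_on Y (k \<epsilon>)"
            using k e by (intro smooth_on_continuous0 nets_of_rate_smooth)
          then show "continuous_on (cball y0 (4 * r)) ?\<phi>"
            using r(3) \<psi>(2) by (intro continuous_intros) (auto intro: continuous_on_subset)
          show "ball ye \<rho> \<subseteq> ?W" using sub r(1) by (auto simp: subset_iff)
          fix y
          show "0 \<le> ?\<phi> y" using \<psi>(3) by simp
          assume "y \<in> ball ye \<rho>"
          then show "(s / 2)\<^sup>2 * c \<le> ?\<phi> y"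
            using kl[of y] c sub by (intro mult_mono power_mono) (auto simp: s_def)
        qed auto
        \<comment> \<open>The bound on \<open>I\<close> is uniform over \<open>cball x0 r\<close>,
          hence valid at the moving point \<open>xe\<close>.\<close>
        ultimately have "(s / 2)\<^sup>2 * c * measure lborel (ball ye \<rho>) \<le> D * \<epsilon> ^ q"
          using elim(1) xye(1) by fastforce
        moreover have "measure lborel (ball ye \<rho>) = v * \<epsilon> ^ ((m + n) * ?d)"
          using content_ball[of \<rho> ye] \<rho>(1)
          by (simp add: v_def \<rho>_def power_mult_distrib power_mult)
        ultimately have "s\<^sup>2 / 4 * c * v * \<epsilon> ^ ((m + n) * ?d) \<le> D * \<epsilon> ^ (2 * n) * \<epsilon> ^ ((m + n) * ?d)"
          by (simp add: q_def power_add power_divide mult_ac)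
        then have "s\<^sup>2 / 4 * c * v \<le> D * \<epsilon> ^ (2 * n)" using e by simp
        then have "s\<^sup>2 \<le> E * \<epsilon> ^ (2 * n)"
          using c(1) v by (simp add: E_def field_simps)
        also have "\<dots> \<le> (1 + E)\<^sup>2 * (\<epsilon> ^ n)\<^sup>2"
        proof -
          \<comment> \<open>Bounding by a perfect square allows the root to be taken without
            \<open>sqrt\<close>.\<close>
          have "E \<le> (1 + E)\<^sup>2" using E by (simp add: power2_eq_square algebra_simps)
          then show ?thesis unfolding power_even_eq by (rule mult_right_mono) simp
        qed
        finally have "s\<^sup>2 \<le> ((1 + E) * \<epsilon> ^ n)\<^sup>2" by (simp add: power_mult_distrib)
        then show ?thesis using E e by (auto intro: power2_le_imp_le)
      qed simp
      \<comment> \<open>Which alternative holds may vary with \<open>\<epsilon>\<close>; the sum of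
        the two nonnegative bounds covers both.\<close>
      moreover have "0 \<le> 2 * L * r * \<epsilon> ^ n" "0 \<le> (1 + E) * \<epsilon> ^ n" using L(1) r(1) E e by auto
      ultimately show ?case unfolding s_def distrib_right by linarith
    qed
    then show ?thesis by blast
  qed
  let ?V = "ball x0 r \<times> ball y0 r"
  have V: "open ?V" "?V \<subseteq> X \<times> Y"
    using order_trans[OF Sigma_mono[OF ball_subset_cball ball_subset_cball] Q(3)] by (auto intro!: open_Times)
  have "h \<in> negligible_nets ?V"
    unfolding negligible_nets_eq
  proof (rule negligible_if_order_zero[OF V(1)])
    show "h \<in> nets_of_rate moderate_rates ?V"
      using h V(2) unfolding moderate_nets_eq by (rule nets_of_rate_mono)
    fix K assume K: "compact K" "K \<subseteq> ?V"
    show "bounded_at_rate negligible_rates K h"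
    proof (rule bounded_at_negligible_rateI)
      fix n
      obtain C where C: "\<forall>\<^sub>F \<epsilon> in at_right 0. cmod (h \<epsilon> (p \<epsilon>)) \<le> C * \<epsilon> ^ n" using sup by blast
      have KQ: "K \<subseteq> ?Q" using K(2) by auto
      have "\<forall>\<^sub>F \<epsilon> in at_right 0. \<forall>z\<in>K. cmod (h \<epsilon> z) \<le> C * \<epsilon> ^ n"
        using C eventually_unit
      proof eventually_elim
        case (elim \<epsilon>)
        then show ?case using p(2)[of \<epsilon>] KQ order_trans by blast
      qed
      then show "\<exists>C. \<forall>\<^sub>F \<epsilon> in at_right 0. \<forall>z\<in>K. cmod (h \<epsilon> z) \<le> C * \<epsilon> ^ n" by blast
    qed
  qed
  then show ?thesis using V(1) r(1) by (intro exI[of _ ?V]) simp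
qed

theorem theorem21:
  fixes X :: "(real ^ 'm) set" and Y :: "(real ^ 'n) set"
    and H :: "((real ^ 'm) \<times> (real ^ 'n)) net set"
  assumes "open X" and "open Y" and "H \<in> colombeau_ps X Y"
  shows "(\<forall>f \<in> colombeau Y. gen_integral_op X Y H f = colombeau_zero X)
    \<longleftrightarrow> H = colombeau_zero (X \<times> Y)"
proof -
  note X = assms(1) and Y = assms(2)
  have XY: "open (X \<times> Y)" using X Y by (rule open_Times)
  obtain h where h: "h \<in> moderate_nets (X \<times> Y)" and H: "H = Cl (X \<times> Y) h"
    using assms(3) by (auto simp: colombeau_ps_def colombeau_iff)
  \<comment> \<open>Quantification over classes becomes quantification over moderate nets, the form
    in which the lemmas on the operator are stated.\<close>
  have "colombeau Y = Cl Y ` moderate_nets Y" by (auto simp: colombeau_iff)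
  then have "(\<forall>f\<in>colombeau Y. gen_integral_op X Y H f = colombeau_zero X) \<longleftrightarrow>
      (\<forall>f\<in>moderate_nets Y. gen_integral_op X Y H (Cl Y f) = colombeau_zero X)"
    by simp
  also have "\<dots> \<longleftrightarrow> h \<in> negligible_nets (X \<times> Y)"
  proof
    assume *: "\<forall>f\<in>moderate_nets Y. gen_integral_op X Y H (Cl Y f) = colombeau_zero X"
    show "h \<in> negligible_nets (X \<times> Y)"
    proof (rule negligible_local)
      fix z assume "z \<in> X \<times> Y"
      then show "\<exists>V. open V \<and> z \<in> V \<and> h \<in> negligible_nets V"
        using kernel_negligible_near[OF X Y h] * H by auto
    qed
  next
    assume "h \<in> negligible_nets (X \<times> Y)"
    then show "\<forall>f\<in>moderate_nets Y. gen_integral_op X Y H (Cl Y f) = colombeau_zero X"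
      using gen_integral_op_zero[OF X Y] H by blast
  qed
  also have "\<dots> \<longleftrightarrow> H = colombeau_zero (X \<times> Y)"
    using Cl_eq_zero_iff[OF XY h] H by simp
  finally show ?thesis .
qed

end
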